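(* Let $d\ge 1$ and let $\{\xi(z):z\in\mathbb{Z}^d\}$ be independent identically distributed random variables with distribution function $F(x)=P(\xi(0)\le x)=1-e^{-x^\gamma}$ for $x\ge 0$ (and $F(x)=0$ for $x<0$), for some $0<\gamma<1$. Let $U(t)$ be the total mass of the solution of the parabolic Anderson problem with potential $\xi$ and localized initial condition, and let $L_t=\frac1t\log U(t)$. Then, as $t\to\infty$, $$\frac{L_t-(d\log t)^{1/\gamma}-d\left(\frac1{\gamma^2}-\frac1\gamma\right)(d\log t)^{1/\gamma-1}\log\log t+\frac d\gamma(d\log t)^{1/\gamma-1}\log\log\log t}{(d\log t)^{1/\gamma-1}}\Rightarrow Y,$$ where $\Rightarrow$ denotes convergence in law and $Y$ has the Gumbel distribution $P(Y\le y)=\exp\{-\theta e^{-\gamma y}\}$, $y\in\mathbb{R}$, with $\theta:=2^d d^{\,d(1/\gamma-1)}$.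
   Context: The parabolic Anderson problem is the Cauchy problem $\partial_t u(t,z)=\Delta^{\mathrm d}u(t,z)+\xi(z)u(t,z)$ for $(t,z)\in(0,\infty)\times\mathbb{Z}^d$, $u(0,z)=\mathbf 1_0(z)$, where $(\Delta^{\mathrm d}f)(z)=\sum_{y\sim z}[f(y)-f(z)]$ is the discrete Laplacian (sum over the $2d$ nearest neighbours of $z$). For the potentials considered here it almost surely has a unique nonnegative solution $u$; its total mass is $U(t)=\sum_{z\in\mathbb{Z}^d}u(t,z)$. By the Feynman–Kac formula, $U(t)=\mathbb{E}_0[\exp\{\int_0^t\xi(X_s)\,ds\}]$, where $(X_s)_{s\ge0}$ is the continuous-time simple random walk on $\mathbb{Z}^d$ with generator $\Delta^{\mathrm d}$ (total jump rate $2d$), independent of $\xi$, started at $0$, and $\mathbb{E}_0$ denotes expectation over the walk only. *)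

theory Defs
  imports "HOL-Probability.Probability"
begin

text \<open>The lattice \<open>\<int>\<^sup>d\<close> is the type \<^typ>\<open>int ^ 'd\<close>, with \<open>d = CARD('d)\<close>.\<close>

definition lattice_nbrs :: "int ^ 'd \<Rightarrow> (int ^ 'd) set" where
  "lattice_nbrs z = (\<Union>i. {z + axis i 1, z - axis i 1})"

lemma finite_lattice_nbrs: "finite (lattice_nbrs (z :: int ^ 'd))"
  by (simp add: lattice_nbrs_def)

lemma card_lattice_nbrs: "card (lattice_nbrs (z :: int ^ 'd)) = 2 * CARD('d)"
proof -
  let ?f = "\<lambda>(i::'d, s::int). z + axis i s"
  have "lattice_nbrs z = ?f ` (UNIV \<times> {1, -1})"
    by (force simp: lattice_nbrs_def axis_def vec_eq_iff image_iff)
  moreover have "inj_on ?f (UNIV \<times> {1, -1})"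
    by (auto simp: inj_on_def axis_eq_axis)
  ultimately show ?thesis
    by (simp add: card_image card_cartesian_product mult.commute)
qed

definition discrete_laplacian :: "(int ^ 'd \<Rightarrow> real) \<Rightarrow> int ^ 'd \<Rightarrow> real" where
  "discrete_laplacian f z = (\<Sum>y\<in>lattice_nbrs z. f y - f z)"

text \<open>Nonnegative solution of the parabolic Anderson problem with (deterministic) potential
  \<open>V\<close> and initial condition \<open>\<one>\<^sub>0\<close>: the equation holds classically for \<open>t > 0\<close>, and the initial
  datum is attained continuously.\<close>

definition pam_solution :: "(int ^ 'd \<Rightarrow> real) \<Rightarrow> (real \<Rightarrow> int ^ 'd \<Rightarrow> real) \<Rightarrow> bool" where
  "pam_solution V u \<longleftrightarrow>
     (\<forall>t\<ge>0. \<forall>z. 0 \<le> u t z) \<and>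
     (\<forall>t>0. \<forall>z. ((\<lambda>s. u s z) has_real_derivative
                    (discrete_laplacian (u t) z + V z * u t z)) (at t)) \<and>
     (\<forall>z. u 0 z = of_bool (z = 0)) \<and>
     (\<forall>z. ((\<lambda>t. u t z) \<longlongrightarrow> u 0 z) (at_right 0))"

text \<open>\<open>infsum\<close> is \<open>0\<close> for a non-summable family; for the potentials considered here the total mass
  is almost surely finite.\<close>

definition total_mass :: "(real \<Rightarrow> int ^ 'd \<Rightarrow> real) \<Rightarrow> real \<Rightarrow> real" where
  "total_mass u t = (\<Sum>\<^sub>\<infinity>z. u t z)"

definition weibull_cdf :: "real \<Rightarrow> real \<Rightarrow> real" where
  "weibull_cdf \<gamma> x = (if x < 0 then 0 else 1 - exp (- (x powr \<gamma>)))"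

text \<open>Convergence in law along an arbitrary filter; for \<^const>\<open>sequentially\<close> this is
  \<^const>\<open>weak_conv_m\<close>.\<close>

definition weak_conv_along :: "('i \<Rightarrow> real measure) \<Rightarrow> real measure \<Rightarrow> 'i filter \<Rightarrow> bool" where
  "weak_conv_along \<mu> \<nu> F \<longleftrightarrow>
     (\<forall>y. isCont (cdf \<nu>) y \<longrightarrow> ((\<lambda>i. cdf (\<mu> i) y) \<longlongrightarrow> cdf \<nu> y) F)"

lemma weak_conv_along_sequentially:
  "weak_conv_along \<mu> \<nu> sequentially \<longleftrightarrow> weak_conv_m \<mu> \<nu>"
  by (simp add: weak_conv_along_def weak_conv_m_def weak_conv_def)

end

theory Submission
  imports Defs "HOL-Real_Asymp.Real_Asymp"
begin

text \<open>The walk maximises its Feynman--Kac weight by running quickly to one site \<open>z\<close> and staying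
  there. With \<open>n = \<bar>z\<bar>\<close> (graph distance from the origin) and \<open>\<xi>(z)\<close> of size \<open>A\<close>, running there in
  time \<open>n/A\<close> has probability \<open>A\<^sup>-\<^sup>n\<close> up to factors exponential in \<open>n\<close>, so that
  \<open>L\<^sub>t \<approx> max\<^sub>z (\<xi>(z) - (\<bar>z\<bar>/t) ln A)\<close>. The errors are bounded, up to a bounded multiple of
  \<open>\<bar>z\<bar>/t\<close>, and a bounded error is negligible because the fluctuations live on the scale
  \<open>\<sigma>\<^sub>t = (d ln t)\<^bsup>1/\<gamma>-1\<^esup> \<rightarrow> \<infinity>\<close>; this is where \<open>\<gamma> < 1\<close> enters. Hence \<open>L\<^sub>t \<le> A\<close> has approximately the
  probability that no site satisfies \<open>\<xi>(z) > A + (\<beta>/t)\<bar>z\<bar>\<close> with \<open>\<beta> \<sim> (1/\<gamma>) ln ln t\<close>, and by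
  independence this is about \<open>exp (- \<Sum>\<^sub>z exp (- (A + (\<beta>/t)\<bar>z\<bar>)\<^sup>\<gamma>))\<close>. Linearising the power,
  the sum is \<open>exp (- A\<^sup>\<gamma>)\<close> times a \<open>d\<close>-fold geometric series, that is, asymptotically
  \<open>exp (- A\<^sup>\<gamma>) (2t / (\<gamma> A\<^bsup>\<gamma>-1\<^esup> \<beta>))\<^sup>d\<close>, and the centring is chosen so that this converges to
  \<open>\<theta> exp (- \<gamma> y)\<close> for the level \<open>A\<close> that corresponds to \<open>y\<close> (\<open>level_sum_tendsto\<close>).

  The lower bound on the total mass needs only the differential inequality along one lattice
  path (\<open>ln_total_mass_lower_bound\<close>). For the upper bound, solutions are paired with
  supersolutions of the backward equation. If \<open>V(z) + \<Sum>\<^bsub>y\<sim>z\<^esub> (exp (s (g y - g z)) - 1) \<le> g z\<close>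
  for \<open>0 \<le> s \<le> t\<close>, then \<open>exp (s g(z))\<close> is a supersolution and the total mass at time \<open>t\<close> is at
  most \<open>2 exp (t g(0))\<close> (\<open>total_mass_upper_bound\<close>). The function \<open>g z = A + (ln K / t) D(z)\<close> works
  when \<open>D\<close> is the distance to the origin in which steps into or out of a shell that contains a
  high peak cost nothing, and \<open>K\<close> is of the order of the gap between \<open>A\<close> and the height \<open>h\<close> above
  which a site counts as a peak (\<open>total_mass_upper_bound_sparse_peaks\<close>): at a peak the
  Laplacian of the supersolution vanishes, elsewhere the gap pays for it. Since with high
  probability there are only \<open>t\<^bsup>1/2\<^esup>\<close> peaks in the relevant region, \<open>D\<close> differs from the true
  distance by a negligible amount.

  The solution is an arbitrary nonnegative one, so the pairing argument must also exclude
  mass that enters from infinity. A nonnegative solution grows at most like \<open>n! / S\<^sup>n\<close> at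
  distance \<open>n\<close>, with \<open>S\<close> as large as one likes because the solution exists for all times, and a
  second supersolution that decays like \<open>1 / n!\<close> kills this growth.\<close>

section \<open>Geometry of the lattice\<close>

text \<open>The graph distance from the origin, which is the number of jumps that the walk needs.\<close>

definition l1 :: "int ^ 'd \<Rightarrow> nat" where
  "l1 z = (\<Sum>i\<in>UNIV. nat \<bar>z $ i\<bar>)"

lemma l1_zero [simp]: "l1 0 = 0"
  by (simp add: l1_def)

lemma l1_eq_0_iff [simp]: "l1 z = 0 \<longleftrightarrow> z = 0"
  by (auto simp: l1_def vec_eq_iff)

lemma l1_component: "nat \<bar>z $ i\<bar> \<le> l1 z"
  unfolding l1_def by (rule member_le_sum) auto

lemma l1_uminus [simp]: "l1 (- z) = l1 z"
  by (simp add: l1_def)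

lemma l1_shift: "l1 z = nat \<bar>z $ i\<bar> + (\<Sum>j\<in>UNIV-{i}. nat \<bar>z $ j\<bar>)"
  unfolding l1_def by (subst sum.remove[of _ i]) auto

lemma l1_add_axis:
  "l1 (z + axis i s) + nat \<bar>z $ i\<bar> = l1 z + nat \<bar>z $ i + s\<bar>"
proof -
  have "(\<Sum>j\<in>UNIV-{i}. nat \<bar>(z + axis i s) $ j\<bar>) = (\<Sum>j\<in>UNIV-{i}. nat \<bar>z $ j\<bar>)"
    by (rule sum.cong) (auto simp: axis_def)
  then show ?thesis
    using l1_shift[of z i] l1_shift[of "z + axis i s" i] by (simp add: axis_def)
qed

lemma lattice_nbrs_iff: "y \<in> lattice_nbrs z \<longleftrightarrow> (\<exists>i s. \<bar>s\<bar> = 1 \<and> y = z + axis i s)"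
proof -
  have "z - axis i 1 = z + axis i (-1)" for i
    by (simp add: vec_eq_iff axis_def)
  then show ?thesis
    unfolding lattice_nbrs_def
    by (auto simp: abs_eq_iff' simp del: add_uminus_conv_diff) (metis abs_1 abs_minus_cancel)+
qed

lemma lattice_nbrs_sym: "y \<in> lattice_nbrs z \<longleftrightarrow> z \<in> lattice_nbrs y"
proof -
  have "z \<in> lattice_nbrs y" if yz: "y \<in> lattice_nbrs z" for y z :: "int ^ 'd"
  proof -
    obtain i s where "\<bar>s\<bar> = 1" "y = z + axis i s"
      using yz lattice_nbrs_iff by blast
    then have "\<bar>-s\<bar> = 1" "z = y + axis i (-s)"
      by (auto simp: vec_eq_iff axis_def)
    then show ?thesis
      using lattice_nbrs_iff by blast
  qed
  then show ?thesis
    by blast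
qed

lemma l1_nbr:
  assumes "y \<in> lattice_nbrs z"
  shows "l1 y = Suc (l1 z) \<or> Suc (l1 y) = l1 z"
proof -
  obtain i s where s: "\<bar>s\<bar> = 1" "y = z + axis i s"
    using assms lattice_nbrs_iff by blast
  show ?thesis
    using l1_add_axis[of z i s] l1_component[of z i] s by (auto simp: abs_if split: if_splits)
qed

text \<open>One step of a shortest path from \<open>x\<close> to \<open>z\<close>.\<close>

lemma nbr_towards:
  assumes "l1 (x - z) = Suc n"
  obtains y where "y \<in> lattice_nbrs x" "l1 (y - z) = n"
proof -
  have "x - z \<noteq> 0"
    using assms by auto
  then obtain i where i: "(x - z) $ i \<noteq> 0"
    by (auto simp: vec_eq_iff)
  define s where "s = - sgn ((x - z) $ i)"
  have s: "\<bar>s\<bar> = 1"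
    using i by (simp add: s_def abs_sgn_eq)
  have "nat \<bar>(x - z) $ i + s\<bar> + 1 = nat \<bar>(x - z) $ i\<bar>"
    using i by (auto simp: s_def sgn_if)
  then have "l1 (x - z + axis i s) = n"
    using l1_add_axis[of "x - z" i s] assms by linarith
  moreover have "x - z + axis i s = (x + axis i s) - z"
    by simp
  ultimately show ?thesis
    using that[of "x + axis i s"] s lattice_nbrs_iff by metis
qed

text \<open>Finite regions are cubes rather than balls of \<^const>\<open>l1\<close>, since a sum over a cube of a product of
  functions of the coordinates factorises.\<close>

definition cube :: "nat \<Rightarrow> (int ^ 'd) set" where
  "cube m = {z. \<forall>i. z $ i \<in> {- int m..int m}}"

lemma cube_eq: "cube m = vec_lambda ` (PiE UNIV (\<lambda>_. {- int m..int m}))"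
proof -
  have "z \<in> vec_lambda ` (PiE UNIV (\<lambda>_. {- int m..int m}))" if "z \<in> cube m" for z :: "int ^ 'd"
    using that by (intro image_eqI[of _ _ "vec_nth z"]) (auto simp: cube_def PiE_def)
  then show ?thesis
    by (auto simp: cube_def)
qed

lemma finite_cube [simp]: "finite (cube m)"
  unfolding cube_eq by (intro finite_imageI finite_PiE) auto

lemma sum_cube_prod:
  fixes f :: "int \<Rightarrow> real"
  shows "(\<Sum>z\<in>cube m. \<Prod>i\<in>UNIV. f ((z :: int ^ 'd) $ i)) = (\<Sum>k\<in>{- int m..int m}. f k) ^ CARD('d)"
proof -
  have "(\<Sum>z\<in>cube m. \<Prod>i\<in>UNIV. f ((z :: int ^ 'd) $ i)) =
        (\<Sum>p\<in>PiE UNIV (\<lambda>_. {- int m..int m}). \<Prod>i\<in>(UNIV::'d set). f (p i))"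
    unfolding cube_eq
    by (subst sum.reindex) (auto simp: inj_on_def vec_lambda_inject)
  also have "\<dots> = (\<Prod>i\<in>(UNIV::'d set). \<Sum>k\<in>{- int m..int m}. f k)"
    by (subst prod_sum_PiE) auto
  finally show ?thesis
    by simp
qed

lemma card_cube: "card (cube m :: (int ^ 'd) set) = (2 * m + 1) ^ CARD('d)"
proof -
  have "real (card (cube m :: (int ^ 'd) set)) = real (nat (2 * int m + 1)) ^ CARD('d)"
    using sum_cube_prod[of "\<lambda>_. 1" m, where 'd='d] by simp
  then have "real (card (cube m :: (int ^ 'd) set)) = real ((2 * m + 1) ^ CARD('d))"
    by (simp add: nat_add_distrib nat_mult_distrib algebra_simps)
  then show ?thesis
    using of_nat_eq_iff by blast
qed

lemma l1_ball_subset_cube: "l1 z \<le> m \<Longrightarrow> z \<in> cube m"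
proof -
  assume "l1 z \<le> m"
  then have "nat \<bar>z $ i\<bar> \<le> m" for i
    using l1_component[of z i] by linarith
  then have "\<bar>z $ i\<bar> \<le> int m" for i
    by (simp add: nat_le_iff)
  then show ?thesis
    unfolding cube_def by (simp add: abs_le_iff) (metis minus_le_iff)
qed

lemma finite_l1_ball [simp]: "finite {z. l1 z \<le> m}"
  by (rule finite_subset[OF _ finite_cube[of m]]) (auto intro: l1_ball_subset_cube)

lemma l1_gt_outside_cube: "z \<notin> cube m \<Longrightarrow> m < l1 z"
  using l1_ball_subset_cube not_le by blast

lemma l1_le_in_cube:
  assumes "(z :: int ^ 'd) \<in> cube m"
  shows "l1 z \<le> CARD('d) * m"
proof -
  have "nat \<bar>z $ i\<bar> \<le> m" for i
  proof -
    have "z $ i \<in> {- int m..int m}"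
      using assms unfolding cube_def by blast
    then show ?thesis
      by (auto simp: nat_le_iff abs_le_iff)
  qed
  then have "l1 z \<le> (\<Sum>i\<in>(UNIV::'d set). m)"
    unfolding l1_def by (intro sum_mono) auto
  then show ?thesis
    by simp
qed

section \<open>Solutions grow along lattice paths\<close>

lemma pam_nonneg: "pam_solution V u \<Longrightarrow> 0 \<le> t \<Longrightarrow> 0 \<le> u t z"
  by (simp add: pam_solution_def)

lemma pam_deriv:
  "pam_solution V u \<Longrightarrow> 0 < t \<Longrightarrow>
    ((\<lambda>s. u s z) has_real_derivative (discrete_laplacian (u t) z + V z * u t z)) (at t)"
  by (simp add: pam_solution_def)

lemma pam_initial: "pam_solution V u \<Longrightarrow> u 0 z = of_bool (z = 0)"
  by (simp add: pam_solution_def)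

lemma pam_continuous:
  assumes "pam_solution V u"
  shows "continuous_on {0..T} (\<lambda>s. u s z)"
proof -
  have "((\<lambda>s. u s z) \<longlongrightarrow> u s z) (at s within {0..})" if "s \<ge> 0" for s
  proof (cases "s = 0")
    case True
    have "((\<lambda>t. u t z) \<longlongrightarrow> u 0 z) (at 0 within {0..})"
      using assms unfolding pam_solution_def at_within_Ici_at_right by blast
    with True show ?thesis
      by simp
  next
    case False
    then have "isCont (\<lambda>s. u s z) s"
      using pam_deriv[OF assms, of s z] that DERIV_isCont by fastforce
    then show ?thesis
      by (meson continuous_within isCont_def tendsto_within_subset top_greatest)
  qed
  then have "continuous_on {0..} (\<lambda>s. u s z)"
    by (simp add: continuous_on)
  then show ?thesis
    by (rule continuous_on_subset) auto
qed

lemma laplacian_eq: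
  "discrete_laplacian f (z :: int ^ 'd) = (\<Sum>y\<in>lattice_nbrs z. f y) - 2 * real CARD('d) * f z"
  by (simp add: discrete_laplacian_def sum_subtractf card_lattice_nbrs)

text \<open>Since the potential is nonnegative, \<open>(exp (2 d r) u(r, x))' \<ge> exp (2 d r) u(r, y)\<close> for each
  neighbour \<open>y\<close> of \<open>x\<close>; integrating this along a shortest path gives one factor \<open>\<tau> / k\<close> per step.
  The lemma serves twice: it carries the initial mass from the origin to a good site, and,
  with the origin as the end point, it bounds the growth of an arbitrary nonnegative
  solution at infinity.\<close>

lemma pam_path_lower_bound:
  fixes V :: "int ^ 'd \<Rightarrow> real"
  assumes u: "pam_solution V u" and V: "\<And>z. 0 \<le> V z" and s0: "0 \<le> s\<^sub>0" and \<tau>: "0 \<le> \<tau>"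
    and n: "l1 (x - z) = n"
  shows "\<tau> ^ n / fact n * u s\<^sub>0 z \<le> exp (2 * real CARD('d) * \<tau>) * u (s\<^sub>0 + \<tau>) x"
proof -
  let ?c = "2 * real CARD('d)"
  have deriv: "((\<lambda>\<tau>. exp (?c * \<tau>) * u (s\<^sub>0 + \<tau>) x) has_real_derivative
      exp (?c * \<tau>) * ((\<Sum>y\<in>lattice_nbrs x. u (s\<^sub>0 + \<tau>) y) + V x * u (s\<^sub>0 + \<tau>) x)) (at \<tau>)"
    if "\<tau> > 0" for \<tau> x
  proof -
    have u': "((\<lambda>\<tau>. u (s\<^sub>0 + \<tau>) x) has_real_derivative
        (discrete_laplacian (u (s\<^sub>0 + \<tau>)) x + V x * u (s\<^sub>0 + \<tau>) x)) (at \<tau>)"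
      using pam_deriv[OF u, of "\<tau> + s\<^sub>0" x] that s0 DERIV_shift[of "\<lambda>s. u s x" _ \<tau> s\<^sub>0]
      by (simp add: add.commute)
    have exp': "((\<lambda>\<tau>. exp (?c * \<tau>)) has_real_derivative exp (?c * \<tau>) * ?c) (at \<tau>)"
      by (auto intro!: derivative_eq_intros)
    have "((\<lambda>\<tau>. exp (?c * \<tau>) * u (s\<^sub>0 + \<tau>) x) has_real_derivative
        exp (?c * \<tau>) * ?c * u (s\<^sub>0 + \<tau>) x +
        (discrete_laplacian (u (s\<^sub>0 + \<tau>)) x + V x * u (s\<^sub>0 + \<tau>) x) * exp (?c * \<tau>)) (at \<tau>)"
      by (rule DERIV_mult[OF exp' u'])
    then show ?thesis
      by (rule DERIV_cong) (simp add: laplacian_eq algebra_simps)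
  qed
  have cont: "continuous_on {0..T} (\<lambda>\<tau>. exp (?c * \<tau>) * u (s\<^sub>0 + \<tau>) x)" for T x
  proof -
    have "continuous_on {0..T} (\<lambda>\<tau>. u (s\<^sub>0 + \<tau>) x)"
      by (rule continuous_on_compose2[OF pam_continuous[OF u, of "s\<^sub>0 + T" x]])
        (use s0 in \<open>auto intro!: continuous_intros\<close>)
    then show ?thesis
      by (intro continuous_intros)
  qed
  have nn: "0 \<le> u (s\<^sub>0 + \<tau>) x" if "\<tau> \<ge> 0" for \<tau> x
    using pam_nonneg[OF u] s0 that by simp
  show ?thesis
    using \<tau> n
  proof (induction n arbitrary: x \<tau>)
    case 0
    have "exp (?c * 0) * u (s\<^sub>0 + 0) x \<le> exp (?c * \<tau>) * u (s\<^sub>0 + \<tau>) x"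
    proof (rule DERIV_nonneg_imp_increasing_open[where f = "\<lambda>\<tau>. exp (?c * \<tau>) * u (s\<^sub>0 + \<tau>) x"])
      fix r :: real assume r: "0 < r" "r < \<tau>"
      have "0 \<le> exp (?c * r) * ((\<Sum>y\<in>lattice_nbrs x. u (s\<^sub>0 + r) y) + V x * u (s\<^sub>0 + r) x)"
        using nn V r by (intro mult_nonneg_nonneg add_nonneg_nonneg sum_nonneg) auto
      then show "\<exists>y. ((\<lambda>\<tau>. exp (?c * \<tau>) * u (s\<^sub>0 + \<tau>) x) has_real_derivative y) (at r) \<and> 0 \<le> y"
        using deriv[OF r(1), of x] by blast
    qed (use 0 cont in auto)
    with 0 show ?case
      by simp
  next
    case (Suc n)
    obtain y where y: "y \<in> lattice_nbrs x" "l1 (y - z) = n"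
      using nbr_towards Suc.prems by blast
    define h where "h \<tau> = exp (?c * \<tau>) * u (s\<^sub>0 + \<tau>) x - \<tau> ^ Suc n / fact (Suc n) * u s\<^sub>0 z" for \<tau>
    have "h 0 \<le> h \<tau>"
    proof (rule DERIV_nonneg_imp_increasing_open[where f = h])
      fix r :: real assume r: "0 < r" "r < \<tau>"
      let ?D = "exp (?c * r) * ((\<Sum>y\<in>lattice_nbrs x. u (s\<^sub>0 + r) y) + V x * u (s\<^sub>0 + r) x) - r ^ n / fact n * u s\<^sub>0 z"
      have "((\<lambda>\<tau>. \<tau> ^ Suc n / fact (Suc n) * u s\<^sub>0 z) has_real_derivative (real (Suc n) * r ^ n) / fact (Suc n) * u s\<^sub>0 z) (at r)"
        by (auto intro!: derivative_eq_intros simp del: power_Suc fact_Suc)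
      moreover have "(real (Suc n) * r ^ n) / fact (Suc n) = r ^ n / fact n"
        by (simp add: divide_simps)
      ultimately have "((\<lambda>\<tau>. \<tau> ^ Suc n / fact (Suc n) * u s\<^sub>0 z) has_real_derivative
          r ^ n / fact n * u s\<^sub>0 z) (at r)"
        by (simp only:)
      then have "(h has_real_derivative ?D) (at r)"
        unfolding h_def by (rule DERIV_diff[OF deriv[OF r(1)]])
      moreover have "0 \<le> ?D"
      proof -
        have "r ^ n / fact n * u s\<^sub>0 z \<le> exp (?c * r) * u (s\<^sub>0 + r) y"
          using Suc.IH[of r y] y r by simp
        also have "u (s\<^sub>0 + r) y \<le> (\<Sum>y\<in>lattice_nbrs x. u (s\<^sub>0 + r) y)"
          by (rule member_le_sum) (use y nn r finite_lattice_nbrs in auto)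
        also have "\<dots> \<le> \<dots> + V x * u (s\<^sub>0 + r) x"
          using V nn r by simp
        finally show ?thesis
          by (simp add: mult_left_mono)
      qed
      ultimately show "\<exists>y. (h has_real_derivative y) (at r) \<and> 0 \<le> y"
        by blast
    next
      show "continuous_on {0..\<tau>} h"
        unfolding h_def by (intro continuous_on_diff cont) (intro continuous_intros, auto)
    qed (use Suc.prems in auto)
    moreover have "0 \<le> h 0"
      using nn[of 0 x] by (simp add: h_def)
    ultimately show ?case
      by (simp add: h_def)
  qed
qed


section \<open>Supersolutions dominate the total mass\<close>

text \<open>The harmonic mean \<open>H(a, b) = a b / (a + b)\<close> is increasing, concave and homogeneous of degree
  one, so that \<open>\<nabla>H(a, b) \<bullet> (p, q) \<ge> H(p, q)\<close>. Therefore the harmonic mean of two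
  supersolutions is a supersolution. It is a smooth substitute for the minimum, equal to it
  up to a factor two; \<open>a'\<close> and \<open>b'\<close> stand for the time derivatives, \<open>p\<close> and \<open>q\<close> for the values at
  the neighbours.\<close>

lemma harmonic_mean_supersolution:
  fixes a b :: real
  assumes ab: "0 < a" "0 < b" and pq: "\<And>y. y \<in> Y \<Longrightarrow> 0 < p y" "\<And>y. y \<in> Y \<Longrightarrow> 0 < q y"
    and a': "(\<Sum>y\<in>Y. p y) + c * a \<le> a'" and b': "(\<Sum>y\<in>Y. q y) + c * b \<le> b'"
  shows "(\<Sum>y\<in>Y. p y * q y / (p y + q y)) + c * (a * b / (a + b))
           \<le> (b\<^sup>2 * a' + a\<^sup>2 * b') / (a + b)\<^sup>2"
proof -
  have *: "p y * q y / (p y + q y) \<le> (b\<^sup>2 * p y + a\<^sup>2 * q y) / (a + b)\<^sup>2" if "y \<in> Y" for y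
  proof -
    have "0 \<le> (b * p y - a * q y)\<^sup>2"
      by simp
    then have "(p y * q y) * (a + b)\<^sup>2 \<le> (b\<^sup>2 * p y + a\<^sup>2 * q y) * (p y + q y)"
      by (simp add: power2_eq_square algebra_simps)
    moreover have "0 < p y + q y" "0 < (a + b)\<^sup>2"
      using pq[OF that] ab by auto
    ultimately show ?thesis
      by (simp add: divide_simps)
  qed
  have "c * (a * b / (a + b)) = (b\<^sup>2 * (c * a) + a\<^sup>2 * (c * b)) / (a + b)\<^sup>2"
  proof -
    have "b\<^sup>2 * (c * a) + a\<^sup>2 * (c * b) = c * a * b * (a + b)"
      by (simp add: power2_eq_square algebra_simps)
    then show ?thesis
      using ab by (simp add: power2_eq_square)
  qed
  then have "(\<Sum>y\<in>Y. p y * q y / (p y + q y)) + c * (a * b / (a + b))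
      \<le> (\<Sum>y\<in>Y. (b\<^sup>2 * p y + a\<^sup>2 * q y) / (a + b)\<^sup>2) + (b\<^sup>2 * (c * a) + a\<^sup>2 * (c * b)) / (a + b)\<^sup>2"
    using sum_mono[of Y, OF *] by simp
  also have "\<dots> = (b\<^sup>2 * ((\<Sum>y\<in>Y. p y) + c * a) + a\<^sup>2 * ((\<Sum>y\<in>Y. q y) + c * b)) / (a + b)\<^sup>2"
    by (simp add: sum.distrib add_divide_distrib distrib_left flip: sum_distrib_left sum_divide_distrib)
  also have "\<dots> \<le> (b\<^sup>2 * a' + a\<^sup>2 * b') / (a + b)\<^sup>2"
    using a' b' by (intro divide_right_mono add_mono mult_left_mono) auto
  finally show ?thesis .
qed

text \<open>Summation by parts inside a finite region.\<close>

lemma sum_swap_nbrs: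
  fixes F :: "int ^ 'd \<Rightarrow> int ^ 'd \<Rightarrow> real"
  assumes "finite B"
  shows "(\<Sum>z\<in>B. \<Sum>y\<in>lattice_nbrs z \<inter> B. F y z) = (\<Sum>z\<in>B. \<Sum>y\<in>lattice_nbrs z \<inter> B. F z y)"
proof -
  have "(\<Sum>z\<in>B. \<Sum>y\<in>lattice_nbrs z \<inter> B. F y z) = (\<Sum>z\<in>B. \<Sum>y\<in>B. if y \<in> lattice_nbrs z then F y z else 0)"
    using assms by (intro sum.cong[OF refl, of B]) (simp add: Int_commute[of _ B] sum.inter_restrict)
  also have "\<dots> = (\<Sum>y\<in>B. \<Sum>z\<in>B. if y \<in> lattice_nbrs z then F y z else 0)"
    by (rule sum.swap)
  also have "\<dots> = (\<Sum>y\<in>B. \<Sum>z\<in>B. if z \<in> lattice_nbrs y then F y z else 0)"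
    by (intro sum.cong refl if_cong lattice_nbrs_sym)
  also have "\<dots> = (\<Sum>z\<in>B. \<Sum>y\<in>lattice_nbrs z \<inter> B. F z y)"
    using assms by (intro sum.cong[OF refl, of B]) (simp add: Int_commute[of _ B] sum.inter_restrict)
  finally show ?thesis .
qed

text \<open>Running the supersolution \<open>\<phi>\<close> backwards makes \<open>\<Sum>\<^bsub>z\<in>B\<^esub> u(s, z) \<phi>(t - s, z)\<close> decreasing in \<open>s\<close>,
  except for the mass that enters \<open>B\<close> through its boundary; the hypothesis on \<open>\<epsilon>\<close> bounds this
  flux.\<close>

lemma pairing_with_supersolution:
  fixes V :: "int ^ 'd \<Rightarrow> real" and \<phi> :: "real \<Rightarrow> int ^ 'd \<Rightarrow> real"
  assumes u: "pam_solution V u" and t: "0 < t" and B: "finite B"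
    and \<phi>': "\<And>s z. 0 \<le> s \<Longrightarrow> s \<le> t \<Longrightarrow> ((\<lambda>s. \<phi> s z) has_real_derivative \<phi>' s z) (at s)"
    and super: "\<And>s z. 0 \<le> s \<Longrightarrow> s \<le> t \<Longrightarrow> z \<in> B \<Longrightarrow> discrete_laplacian (\<phi> s) z + V z * \<phi> s z \<le> \<phi>' s z"
    and pos: "\<And>s z. 0 \<le> s \<Longrightarrow> s \<le> t \<Longrightarrow> 0 \<le> \<phi> s z"
    and flux: "\<And>s z y. 0 \<le> s \<Longrightarrow> s \<le> t \<Longrightarrow> z \<in> B \<Longrightarrow> y \<in> lattice_nbrs z \<Longrightarrow> y \<notin> B \<Longrightarrow>
        u s y * \<phi> (t - s) z \<le> \<epsilon>"
    and \<epsilon>: "0 \<le> \<epsilon>"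
  shows "(\<Sum>z\<in>B. u t z * \<phi> 0 z) \<le> (\<Sum>z\<in>B. u 0 z * \<phi> t z) + t * (2 * real CARD('d) * real (card B) * \<epsilon>)"
proof -
  define K where "K = 2 * real CARD('d) * real (card B) * \<epsilon>"
  define \<Phi> where "\<Phi> s = (\<Sum>z\<in>B. u s z * \<phi> (t - s) z)" for s
  define h where "h s = \<Phi> s - s * K" for s
  have \<phi>d: "((\<lambda>s. \<phi> (t - s) z) has_real_derivative - \<phi>' (t - s) z) (at s)" if "0 \<le> s" "s \<le> t" for s z
  proof -
    have "((\<lambda>s. \<phi> (t - s) z) has_real_derivative \<phi>' (t - s) z * (0 - 1)) (at s)"
      by (rule DERIV_chain2[OF \<phi>']) (use that in \<open>auto intro!: derivative_eq_intros\<close>)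
    then show ?thesis
      by simp
  qed
  have "h t \<le> h 0"
  proof (rule DERIV_nonpos_imp_decreasing_open[where f = h])
    show "0 \<le> t"
      using t by simp
    have "continuous_on {0..t} (\<lambda>s. \<phi> (t - s) z)" for z
      by (rule DERIV_continuous_on) (use \<phi>d in \<open>auto intro: has_field_derivative_at_within\<close>)
    then show "continuous_on {0..t} h"
      unfolding h_def \<Phi>_def by (intro continuous_intros pam_continuous[OF u])
  next
    fix s assume s: "0 < s" "s < t"
    let ?u = "u s" and ?f = "\<phi> (t - s)"
    let ?D = "(\<Sum>z\<in>B. (discrete_laplacian ?u z + V z * ?u z) * ?f z - \<phi>' (t - s) z * ?u z) - K"
    have "((\<lambda>s. u s z * \<phi> (t - s) z) has_real_derivative
        (discrete_laplacian ?u z + V z * ?u z) * ?f z - \<phi>' (t - s) z * ?u z) (at s)" for z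
      by (rule DERIV_cong, rule DERIV_mult[OF pam_deriv[OF u] \<phi>d]) (use s in auto)
    then have "(h has_real_derivative ?D) (at s)"
      unfolding h_def \<Phi>_def
      by (intro DERIV_diff DERIV_sum DERIV_cong[OF DERIV_cmult_right[OF DERIV_ident]]) auto
    moreover have "?D \<le> 0"
    proof -
      have u0: "0 \<le> ?u z" and f0: "0 \<le> ?f z" for z
        using pam_nonneg[OF u] pos s by auto
      have "(discrete_laplacian ?u z + V z * ?u z) * ?f z - \<phi>' (t - s) z * ?u z \<le>
          (\<Sum>y\<in>lattice_nbrs z. ?u y * ?f z - ?u z * ?f y)" if "z \<in> B" for z
      proof -
        have "(discrete_laplacian ?f z + V z * ?f z) * ?u z \<le> \<phi>' (t - s) z * ?u z"
          using super[of "t - s" z] that s u0 by (intro mult_right_mono) auto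
        then show ?thesis
          by (simp add: laplacian_eq sum_subtractf sum_distrib_left sum_distrib_right algebra_simps)
      qed
      then have "(\<Sum>z\<in>B. (discrete_laplacian ?u z + V z * ?u z) * ?f z - \<phi>' (t - s) z * ?u z)
          \<le> (\<Sum>z\<in>B. \<Sum>y\<in>lattice_nbrs z. ?u y * ?f z - ?u z * ?f y)"
        by (rule sum_mono)
      also have "\<dots> = (\<Sum>z\<in>B. \<Sum>y\<in>lattice_nbrs z \<inter> B. ?u y * ?f z - ?u z * ?f y) +
          (\<Sum>z\<in>B. \<Sum>y\<in>lattice_nbrs z - B. ?u y * ?f z - ?u z * ?f y)"
        by (simp add: sum.Int_Diff[OF finite_lattice_nbrs, of _ _ B] flip: sum.distrib)
      also have "(\<Sum>z\<in>B. \<Sum>y\<in>lattice_nbrs z \<inter> B. ?u y * ?f z - ?u z * ?f y) = 0"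
        using sum_swap_nbrs[OF B, of "\<lambda>y z. ?u y * ?f z"] by (simp add: sum_subtractf)
      also have "(\<Sum>z\<in>B. \<Sum>y\<in>lattice_nbrs z - B. ?u y * ?f z - ?u z * ?f y) \<le>
          (\<Sum>z\<in>B. \<Sum>y\<in>lattice_nbrs z. \<epsilon>)"
      proof (rule sum_mono)
        fix z assume z: "z \<in> B"
        have "(\<Sum>y\<in>lattice_nbrs z - B. ?u y * ?f z - ?u z * ?f y) \<le> (\<Sum>y\<in>lattice_nbrs z - B. \<epsilon>)"
        proof (rule sum_mono)
          fix y assume "y \<in> lattice_nbrs z - B"
          then have "?u y * ?f z \<le> \<epsilon>"
            using flux[of s z y] z s by simp
          moreover have "0 \<le> ?u z * ?f y"
            using u0 f0 by simp
          ultimately show "?u y * ?f z - ?u z * ?f y \<le> \<epsilon>"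
            by linarith
        qed
        also have "\<dots> \<le> (\<Sum>y\<in>lattice_nbrs z. \<epsilon>)"
          by (rule sum_mono2) (use \<epsilon> finite_lattice_nbrs in auto)
        finally show "(\<Sum>y\<in>lattice_nbrs z - B. ?u y * ?f z - ?u z * ?f y) \<le> (\<Sum>y\<in>lattice_nbrs z. \<epsilon>)" .
      qed
      also have "(\<Sum>z\<in>B. \<Sum>y\<in>lattice_nbrs z. \<epsilon>) = K"
        by (simp add: card_lattice_nbrs K_def)
      finally show ?thesis
        by simp
    qed
    ultimately show "\<exists>y. (h has_real_derivative y) (at s) \<and> y \<le> 0"
      by blast
  qed
  then show ?thesis
    by (simp add: h_def \<Phi>_def K_def)
qed

text \<open>The supersolution \<open>w = exp (s g)\<close> alone gives no control of the flux through a far away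
  boundary, because it grows with the distance. It is therefore combined with
  \<open>\<psi> = exp (s M - \<kappa> (\<bar>z\<bar> - r))\<close>, a supersolution in the ball of radius \<open>R\<close> for any \<open>\<kappa>\<close> if \<open>M\<close>
  exceeds the potential there by \<open>2 d exp \<kappa>\<close>. The choice \<open>\<kappa> = ln (R + 1)\<close> makes \<open>\<psi>\<close> of order \<open>R\<^bsup>-R\<^esup>\<close>
  on the boundary, up to exponential factors. The solution itself is there at most of order
  \<open>(R + 1)! / S\<^bsup>R+1\<^esup>\<close>, so that the flux vanishes as \<open>R \<rightarrow> \<infinity>\<close> once \<open>S\<close> beats the exponential
  factors. The factor two is the price of the harmonic mean.\<close>

lemma total_mass_upper_bound:
  fixes V :: "int ^ 'd \<Rightarrow> real" and g :: "int ^ 'd \<Rightarrow> real"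
  assumes u: "pam_solution V u" and V: "\<And>z. 0 \<le> V z" and t: "0 < t"
    and super: "\<And>s z. 0 \<le> s \<Longrightarrow> s \<le> t \<Longrightarrow>
        V z + (\<Sum>y\<in>lattice_nbrs z. exp (s * (g y - g z)) - 1) \<le> g z"
    and g: "\<And>z. g z \<le> a + b * real (l1 z)" and ab: "0 \<le> a" "0 \<le> b"
  shows "(u t) summable_on UNIV" and "total_mass u t \<le> 2 * exp (t * g 0)"
proof -
  let ?d = "real CARD('d)"
  \<comment> \<open>\<open>S\<close> is an extra span of time; the solution at the origin at time \<open>t + S\<close> controls \<open>u s y\<close> for all \<open>s \<le> t\<close>.\<close>
  define S where "S = 2 * exp (t * b + 2 * ?d * t)"
  define C where "C = exp (2 * ?d * (t + S)) * u (t + S) 0"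
  define \<epsilon> where "\<epsilon> r R = (C * fact (R + 1) / S ^ (R + 1)) *
      exp (t * (a + 2 * ?d + b * real (R + 1) + 2 * ?d * real (R + 1)) - ln (real (R + 1)) * (real R - real r))" for r R
  define flux where "flux r R = t * (2 * ?d * real (card {z :: int ^ 'd. l1 z \<le> R}) * \<epsilon> r R)" for r R
  have S: "S > 0"
    by (simp add: S_def)
  have C: "C \<ge> 0"
    using pam_nonneg[OF u, of "t + S" 0] t S by (simp add: C_def)
  have V_le: "V z \<le> a + 2 * ?d + b * real (l1 z)" for z
    using super[of 0 z] g[of z] t by simp
  have key: "(\<Sum>z | l1 z \<le> r. u t z) \<le> 2 * (exp (t * g 0) + flux r R)" if R: "r \<le> R" for r R
  proof -
    define \<kappa> where "\<kappa> = ln (real (R + 1))"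
    have e\<kappa>: "exp \<kappa> = real (R + 1)" and \<kappa>: "\<kappa> \<ge> 0"
      by (auto simp: \<kappa>_def)
    define M where "M = a + 2 * ?d + b * real (R + 1) + 2 * ?d * real (R + 1)"
    define B where "B = {z :: int ^ 'd. l1 z \<le> R}"
    define w where "w s z = exp (s * g z)" for s z
    define \<psi> where "\<psi> s z = exp (s * M - \<kappa> * (real (l1 z) - real r))" for s and z :: "int ^ 'd"
    define \<phi> where "\<phi> s z = w s z * \<psi> s z / (w s z + \<psi> s z)" for s z
    define \<phi>' where "\<phi>' s z = ((\<psi> s z)\<^sup>2 * (g z * w s z) + (w s z)\<^sup>2 * (M * \<psi> s z)) / (w s z + \<psi> s z)\<^sup>2" for s z
    have wpos: "0 < w s z" and \<psi>pos: "0 < \<psi> s z" for s z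
      by (auto simp: w_def \<psi>_def)
    have sum0: "w s z + \<psi> s z \<noteq> 0" for s z
      using wpos[of s z] \<psi>pos[of s z] by linarith
    have \<phi>_le: "\<phi> s z \<le> w s z" "\<phi> s z \<le> \<psi> s z" "0 \<le> \<phi> s z" for s z
    proof -
      have "w s z * \<psi> s z \<le> w s z * (w s z + \<psi> s z)" "w s z * \<psi> s z \<le> \<psi> s z * (w s z + \<psi> s z)"
        using wpos[of s z] \<psi>pos[of s z] by (auto simp: algebra_simps)
      then show "\<phi> s z \<le> w s z" "\<phi> s z \<le> \<psi> s z" "0 \<le> \<phi> s z"
        using wpos[of s z] \<psi>pos[of s z] unfolding \<phi>_def by (auto simp: divide_simps)
    qed
    have B: "finite B"
      by (simp add: B_def)
    have \<epsilon>0: "0 \<le> \<epsilon> r R"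
      using C S by (simp add: \<epsilon>_def)
    have "(\<Sum>z\<in>B. u t z * \<phi> 0 z) \<le> (\<Sum>z\<in>B. u 0 z * \<phi> t z) + t * (2 * ?d * real (card B) * \<epsilon> r R)"
    proof (rule pairing_with_supersolution[OF u t B, where \<phi>' = \<phi>'])
      fix s z assume s: "0 \<le> s" "s \<le> t"
      have w': "((\<lambda>s. w s z) has_real_derivative g z * w s z) (at s)"
        unfolding w_def by (auto intro!: derivative_eq_intros)
      have \<psi>': "((\<lambda>s. \<psi> s z) has_real_derivative M * \<psi> s z) (at s)"
        unfolding \<psi>_def by (auto intro!: derivative_eq_intros)
      show "((\<lambda>s. \<phi> s z) has_real_derivative \<phi>' s z) (at s)"
        unfolding \<phi>_def \<phi>'_def
        by (rule DERIV_cong, rule DERIV_divide[OF DERIV_mult[OF w' \<psi>'] DERIV_add[OF w' \<psi>'] sum0])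
          (simp add: power2_eq_square algebra_simps)
      show "0 \<le> \<phi> s z"
        by (rule \<phi>_le)
    next
      fix s and z :: "int ^ 'd" assume s: "0 \<le> s" "s \<le> t" and z: "z \<in> B"
      have w_super: "(\<Sum>y\<in>lattice_nbrs z. w s y) + (V z - 2 * ?d) * w s z \<le> g z * w s z"
      proof -
        have w_nbr: "w s y = exp (s * (g y - g z)) * w s z" for y
          by (simp add: w_def right_diff_distrib flip: exp_add)
        have "(\<Sum>y\<in>lattice_nbrs z. w s y) = (\<Sum>y\<in>lattice_nbrs z. exp (s * (g y - g z))) * w s z"
          unfolding sum_distrib_right by (rule sum.cong[OF refl]) (rule w_nbr)
        then have "(\<Sum>y\<in>lattice_nbrs z. w s y) + (V z - 2 * ?d) * w s z =
            (V z + (\<Sum>y\<in>lattice_nbrs z. exp (s * (g y - g z)) - 1)) * w s z"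
          by (simp add: sum_subtractf card_lattice_nbrs left_diff_distrib distrib_right)
        also have "\<dots> \<le> g z * w s z"
          using super[OF s, of z] wpos[of s z] by (intro mult_right_mono) auto
        finally show ?thesis .
      qed
      have \<psi>_super: "(\<Sum>y\<in>lattice_nbrs z. \<psi> s y) + (V z - 2 * ?d) * \<psi> s z \<le> M * \<psi> s z"
      proof -
        have "\<psi> s y \<le> exp \<kappa> * \<psi> s z" if "y \<in> lattice_nbrs z" for y
        proof -
          have "real (l1 z) \<le> real (l1 y) + 1"
            using l1_nbr[OF that] by auto
          then have "\<kappa> * real (l1 z) \<le> \<kappa> * (real (l1 y) + 1)"
            using \<kappa> by (rule mult_left_mono)
          then show ?thesis
            by (simp add: \<psi>_def algebra_simps flip: exp_add)
        qed
        then have "(\<Sum>y\<in>lattice_nbrs z. \<psi> s y) \<le> (\<Sum>y\<in>lattice_nbrs z. exp \<kappa> * \<psi> s z)"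
          by (rule sum_mono)
        also have "\<dots> = 2 * ?d * real (R + 1) * \<psi> s z"
          by (simp add: card_lattice_nbrs e\<kappa>)
        finally have 1: "(\<Sum>y\<in>lattice_nbrs z. \<psi> s y) \<le> 2 * ?d * real (R + 1) * \<psi> s z" .
        have "b * real (l1 z) \<le> b * real (R + 1)"
          using z ab by (intro mult_left_mono) (auto simp: B_def)
        then have "V z - 2 * ?d + 2 * ?d * real (R + 1) \<le> M"
          using V_le[of z] by (simp add: M_def)
        then have "(V z - 2 * ?d + 2 * ?d * real (R + 1)) * \<psi> s z \<le> M * \<psi> s z"
          using \<psi>pos[of s z] by (intro mult_right_mono) auto
        with 1 show ?thesis
          by (simp only: distrib_right)
      qed
      have "(\<Sum>y\<in>lattice_nbrs z. \<phi> s y) + (V z - 2 * ?d) * \<phi> s z \<le> \<phi>' s z"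
        unfolding \<phi>_def \<phi>'_def
        by (rule harmonic_mean_supersolution[OF wpos \<psi>pos wpos \<psi>pos w_super \<psi>_super])
      then show "discrete_laplacian (\<phi> s) z + V z * \<phi> s z \<le> \<phi>' s z"
        by (simp add: laplacian_eq algebra_simps)
    next
      fix s and z y :: "int ^ 'd"
      assume s: "0 \<le> s" "s \<le> t" and z: "z \<in> B" and y: "y \<in> lattice_nbrs z" "y \<notin> B"
      have ly: "l1 y = R + 1" and lz: "l1 z = R"
        using l1_nbr[OF y(1)] z y by (auto simp: B_def)
      have "u s y \<le> C * fact (R + 1) / S ^ (R + 1)"
      proof -
        have "(t + S - s) ^ (R + 1) / fact (R + 1) * u s y \<le> exp (2 * ?d * (t + S - s)) * u (s + (t + S - s)) 0"
          by (rule pam_path_lower_bound[OF u V s(1)]) (use s S ly in auto)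
        also have "\<dots> \<le> C"
          unfolding C_def using pam_nonneg[OF u, of "t + S" 0] t S s
          by (auto intro!: mult_right_mono)
        finally have 1: "(t + S - s) ^ (R + 1) / fact (R + 1) * u s y \<le> C" .
        have "S ^ (R + 1) / fact (R + 1) * u s y \<le> (t + S - s) ^ (R + 1) / fact (R + 1) * u s y"
          using S s pam_nonneg[OF u s(1)] by (intro mult_right_mono divide_right_mono power_mono) auto
        with 1 have "S ^ (R + 1) / fact (R + 1) * u s y \<le> C"
          by linarith
        then show ?thesis
          using S by (simp add: divide_simps mult.commute del: power_Suc fact_Suc)
      qed
      moreover have "\<phi> (t - s) z \<le> exp (t * M - \<kappa> * (real R - real r))"
      proof -
        have "0 \<le> M"
          using ab by (simp add: M_def)
        then have "\<psi> (t - s) z \<le> exp (t * M - \<kappa> * (real R - real r))"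
          using s by (simp add: \<psi>_def lz mult_right_mono)
        then show ?thesis
          using \<phi>_le(2)[of "t - s" z] by linarith
      qed
      ultimately show "u s y * \<phi> (t - s) z \<le> \<epsilon> r R"
        unfolding \<epsilon>_def M_def \<kappa>_def using \<phi>_le(3) C S by (intro mult_mono) auto
    qed (rule \<epsilon>0)
    moreover have "(\<Sum>z\<in>B. u 0 z * \<phi> t z) \<le> exp (t * g 0)"
    proof -
      have "(\<Sum>z\<in>B. u 0 z * \<phi> t z) = (\<Sum>z\<in>B. if z = 0 then \<phi> t z else 0)"
        by (rule sum.cong) (auto simp: pam_initial[OF u])
      also have "\<dots> = \<phi> t 0"
        using B by (simp add: B_def)
      finally show ?thesis
        using \<phi>_le(1)[of t 0] by (simp add: w_def)
    qed
    moreover have "(\<Sum>z | l1 z \<le> r. u t z) / 2 \<le> (\<Sum>z\<in>B. u t z * \<phi> 0 z)"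
    proof -
      have "(\<Sum>z | l1 z \<le> r. u t z) / 2 = (\<Sum>z | l1 z \<le> r. u t z * (1 / 2))"
        by (simp add: sum_divide_distrib)
      also have "\<dots> \<le> (\<Sum>z | l1 z \<le> r. u t z * \<phi> 0 z)"
      proof (intro sum_mono mult_left_mono)
        fix z :: "int ^ 'd" assume "z \<in> {z. l1 z \<le> r}"
        then have "\<kappa> * (real (l1 z) - real r) \<le> 0"
          using \<kappa> by (simp add: mult_nonneg_nonpos)
        then have "1 \<le> \<psi> 0 z"
          by (simp add: \<psi>_def)
        then show "1 / 2 \<le> \<phi> 0 z"
          by (simp add: \<phi>_def w_def divide_simps)
        show "0 \<le> u t z"
          using pam_nonneg[OF u] t by simp
      qed
      also have "\<dots> \<le> (\<Sum>z\<in>B. u t z * \<phi> 0 z)"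
        by (rule sum_mono2[OF B]) (use R t pam_nonneg[OF u] \<phi>_le(3) in \<open>auto simp: B_def\<close>)
      finally show ?thesis .
    qed
    ultimately show ?thesis
      by (simp add: flux_def B_def)
  qed
  have flux_lim: "(\<lambda>R. flux r R) \<longlonglongrightarrow> 0" for r
  proof -
    have e: "exp (t * b + 2 * ?d * t) / S = 1 / 2"
      by (simp add: S_def)
    define Q where "Q = C * exp (t * (a + 2 * ?d)) * t * (2 * ?d)"
    have bound: "flux r R \<le> Q * (real (2 * R + 1) ^ CARD('d) * real (R + 1) ^ (r + 1) * (1 / 2) ^ (R + 1))"
      if R: "r \<le> R" for R
    proof -
      have Rr: "exp (ln (real (R + 1)) * (real R - real r)) = real (R + 1) ^ (R - r)"
        using R by (simp add: exp_of_nat2_mult of_nat_diff[symmetric] del: of_nat_diff)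
      have "(fact (R + 1) :: real) \<le> real (R + 1) ^ (R + 1)"
        using fact_le_power[of "R + 1", where 'a = real] by (simp only: of_nat_power)
      then have f: "fact (R + 1) / real (R + 1) ^ (R - r) \<le> real (R + 1) ^ (r + 1)"
        using R by (simp add: divide_le_eq flip: power_add del: power_Suc fact_Suc of_nat_Suc)
      have "exp (t * (a + 2 * ?d + b * real (R + 1) + 2 * ?d * real (R + 1))) =
          exp (t * (a + 2 * ?d)) * exp (t * b + 2 * ?d * t) ^ (R + 1)"
        by (simp add: algebra_simps flip: exp_of_nat_mult exp_add)
      then have "\<epsilon> r R = C * exp (t * (a + 2 * ?d)) * (exp (t * b + 2 * ?d * t) / S) ^ (R + 1) *
          (fact (R + 1) / real (R + 1) ^ (R - r))"
        unfolding \<epsilon>_def exp_diff Rr by (simp add: power_divide field_simps)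
      also have "\<dots> \<le> C * exp (t * (a + 2 * ?d)) * (exp (t * b + 2 * ?d * t) / S) ^ (R + 1) * real (R + 1) ^ (r + 1)"
        using C S by (intro mult_left_mono[OF f]) auto
      finally have \<epsilon>: "\<epsilon> r R \<le> C * exp (t * (a + 2 * ?d)) * (1 / 2) ^ (R + 1) * real (R + 1) ^ (r + 1)"
        unfolding e .
      have "card {z :: int ^ 'd. l1 z \<le> R} \<le> (2 * R + 1) ^ CARD('d)"
        unfolding card_cube[symmetric] by (rule card_mono) (auto intro: l1_ball_subset_cube)
      then have c: "real (card {z :: int ^ 'd. l1 z \<le> R}) \<le> real (2 * R + 1) ^ CARD('d)"
        by (metis of_nat_le_iff of_nat_power)
      have "flux r R \<le> t * (2 * ?d * real (2 * R + 1) ^ CARD('d) *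
          (C * exp (t * (a + 2 * ?d)) * (1 / 2) ^ (R + 1) * real (R + 1) ^ (r + 1)))"
        unfolding flux_def using C S t
        by (intro mult_left_mono mult_mono c \<epsilon>) (auto simp: \<epsilon>_def)
      then show ?thesis
        by (simp add: Q_def mult_ac)
    qed
    have "(\<lambda>R. Q * (real (2 * R + 1) ^ CARD('d) * real (R + 1) ^ (r + 1) * (1 / 2) ^ (R + 1))) \<longlonglongrightarrow> Q * 0"
      by (intro tendsto_mult_left) real_asymp
    then have lim: "(\<lambda>R. Q * (real (2 * R + 1) ^ CARD('d) * real (R + 1) ^ (r + 1) * (1 / 2) ^ (R + 1))) \<longlonglongrightarrow> 0"
      by simp
    show ?thesis
    proof (rule tendsto_sandwich[OF _ _ tendsto_const lim])
      show "\<forall>\<^sub>F R in sequentially. 0 \<le> flux r R"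
        using C S t by (intro always_eventually) (auto simp: flux_def \<epsilon>_def)
      show "\<forall>\<^sub>F R in sequentially. flux r R \<le>
          Q * (real (2 * R + 1) ^ CARD('d) * real (R + 1) ^ (r + 1) * (1 / 2) ^ (R + 1))"
        using eventually_ge_at_top[of r] by eventually_elim (rule bound)
    qed
  qed
  have ball: "(\<Sum>z | l1 z \<le> r. u t z) \<le> 2 * exp (t * g 0)" for r
  proof (rule tendsto_lowerbound)
    show "(\<lambda>R. 2 * (exp (t * g 0) + flux r R)) \<longlonglongrightarrow> 2 * exp (t * g 0)"
      using tendsto_mult_left[OF tendsto_add[OF tendsto_const[of "exp (t * g 0)"] flux_lim[of r]], of 2] by simp
    show "\<forall>\<^sub>F R in sequentially. (\<Sum>z | l1 z \<le> r. u t z) \<le> 2 * (exp (t * g 0) + flux r R)"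
      using eventually_ge_at_top[of r] by eventually_elim (rule key)
  qed simp
  have fin: "sum (u t) F \<le> 2 * exp (t * g 0)" if "finite F" for F
  proof -
    have "F \<subseteq> {z. l1 z \<le> Max (insert 0 (l1 ` F))}"
      using that by auto
    then have "sum (u t) F \<le> (\<Sum>z | l1 z \<le> Max (insert 0 (l1 ` F)). u t z)"
      using t pam_nonneg[OF u] by (intro sum_mono2) auto
    then show ?thesis
      using ball by (meson order_trans)
  qed
  show summ: "(u t) summable_on UNIV"
    using t pam_nonneg[OF u]
    by (intro nonneg_bounded_partial_sums_imp_summable_on[where C = "2 * exp (t * g 0)"]
        eventually_finite_subsets_at_top_weakI fin) auto
  show "total_mass u t \<le> 2 * exp (t * g 0)"
    unfolding total_mass_def using summ fin by (intro infsum_le_finite_sums) auto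
qed


section \<open>Upper bound for potentials with few high peaks\<close>

text \<open>Shells are numbered by their distance from the origin, and \<open>S\<close> is the set of shells that
  contain a peak. The collapsed distance counts only the steps between two neighbouring
  shells without peaks, so it is constant on a peak together with its neighbours.\<close>

definition collapsed :: "nat set \<Rightarrow> nat \<Rightarrow> nat" where
  "collapsed S n = card {k. k < n \<and> k \<notin> S \<and> Suc k \<notin> S}"

lemma collapsed_0 [simp]: "collapsed S 0 = 0"
  by (simp add: collapsed_def)

lemma collapsed_Suc:
  "collapsed S (Suc n) = (if n \<in> S \<or> Suc n \<in> S then collapsed S n else Suc (collapsed S n))"
proof -
  have "{k. k < Suc n \<and> k \<notin> S \<and> Suc k \<notin> S} =
      (if n \<in> S \<or> Suc n \<in> S then {k. k < n \<and> k \<notin> S \<and> Suc k \<notin> S}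
       else insert n {k. k < n \<and> k \<notin> S \<and> Suc k \<notin> S})"
    by (auto simp: less_Suc_eq)
  then show ?thesis
    by (simp add: collapsed_def)
qed

lemma collapsed_le: "collapsed S n \<le> n"
  by (induction n) (auto simp: collapsed_Suc)

lemma collapsed_ge:
  assumes "finite S"
  shows "n \<le> collapsed S n + 2 * card S"
proof -
  have "{..<n} \<subseteq> {k. k < n \<and> k \<notin> S \<and> Suc k \<notin> S} \<union> (S \<union> (\<lambda>k. k - 1) ` S)"
    by force
  then have "card {..<n} \<le> card ({k. k < n \<and> k \<notin> S \<and> Suc k \<notin> S} \<union> (S \<union> (\<lambda>k. k - 1) ` S))"
    using assms by (intro card_mono) auto
  also have "\<dots> \<le> collapsed S n + card (S \<union> (\<lambda>k. k - 1) ` S)"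
    unfolding collapsed_def by (rule card_Un_le)
  also have "card (S \<union> (\<lambda>k. k - 1) ` S) \<le> card S + card ((\<lambda>k. k - 1) ` S)"
    by (rule card_Un_le)
  also have "card ((\<lambda>k. k - 1) ` S) \<le> card S"
    using assms by (rule card_image_le)
  finally show ?thesis
    by simp
qed

text \<open>Take \<open>g z = A + (ln K / t) D(z)\<close> in the general bound, with \<open>D\<close> the collapsed distance. At a
  peak all differences \<open>g y - g z\<close> vanish and \<open>V z \<le> g z\<close> is all that is needed. At any other
  site they are at most \<open>ln K / t\<close>, so that each neighbour contributes at most \<open>K\<close>, and the gap
  \<open>A - h\<close> pays for it. The term \<open>2 card H\<close> bounds the difference between the distance and the
  collapsed distance.\<close>

lemma total_mass_upper_bound_sparse_peaks:
  fixes V :: "int ^ 'd \<Rightarrow> real"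
  assumes u: "pam_solution V u" and V: "\<And>z. 0 \<le> V z" and t: "0 < t"
    and H: "finite H" and K: "1 \<le> K" and h: "0 \<le> h" "h + 2 * real CARD('d) * K \<le> A"
    and peaks: "\<And>z. z \<in> H \<Longrightarrow> V z \<le> A + (real (l1 z) - 2 * real (card H)) * (ln K / t)"
    and rest: "\<And>z. z \<notin> H \<Longrightarrow> V z \<le> h + max 0 (real (l1 z) - 2 * real (card H)) * (ln K / t)"
  shows "(u t) summable_on UNIV" and "total_mass u t \<le> 2 * exp (t * A)"
proof -
  define b where "b = ln K / t"
  have b: "0 \<le> b" "t * b = ln K"
    using K t by (auto simp: b_def)
  define D where "D z = collapsed (l1 ` H) (l1 z)" for z :: "int ^ 'd"
  define g where "g z = A + real (D z) * b" for z
  have D_ge: "real (l1 z) - 2 * real (card H) \<le> real (D z)" for z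
  proof -
    have "l1 z \<le> D z + 2 * card (l1 ` H)"
      unfolding D_def using H by (intro collapsed_ge) auto
    moreover have "card (l1 ` H) \<le> card H"
      using H by (rule card_image_le)
    ultimately show ?thesis
      by linarith
  qed
  have D_nbr: "real (D y) \<le> real (D z) + 1" if "y \<in> lattice_nbrs z" for y z
    using l1_nbr[OF that] unfolding D_def by (auto simp: collapsed_Suc dest!: sym[of "Suc _"])
  have D_peak: "D y = D z" if "y \<in> lattice_nbrs z" "z \<in> H" for y z
  proof -
    have "l1 z \<in> l1 ` H"
      using that by blast
    then show ?thesis
      using l1_nbr[OF that(1)] collapsed_Suc[of "l1 ` H" "l1 y"] collapsed_Suc[of "l1 ` H" "l1 z"]
      unfolding D_def by presburger
  qed
  have super: "V z + (\<Sum>y\<in>lattice_nbrs z. exp (s * (g y - g z)) - 1) \<le> g z" if s: "0 \<le> s" "s \<le> t" for s z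
  proof (cases "z \<in> H")
    case True
    then have "(\<Sum>y\<in>lattice_nbrs z. exp (s * (g y - g z)) - 1) = 0"
      by (intro sum.neutral) (simp add: g_def D_peak)
    moreover have "(real (l1 z) - 2 * real (card H)) * b \<le> real (D z) * b"
      using D_ge b by (intro mult_right_mono) auto
    ultimately show ?thesis
      using peaks[OF True] by (simp add: g_def b_def)
  next
    case False
    have "exp (s * (g y - g z)) - 1 \<le> K" if "y \<in> lattice_nbrs z" for y
    proof -
      have "s * (g y - g z) = s * b * (real (D y) - real (D z))"
        by (simp add: g_def algebra_simps)
      also have "\<dots> \<le> s * b * 1"
        using D_nbr[OF that] s b by (intro mult_left_mono) auto
      also have "\<dots> \<le> t * b"
        using mult_right_mono[OF s(2) b(1)] by simp
      finally have "exp (s * (g y - g z)) \<le> exp (ln K)"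
        using b by simp
      then show ?thesis
        using K by simp
    qed
    then have "(\<Sum>y\<in>lattice_nbrs z. exp (s * (g y - g z)) - 1) \<le> (\<Sum>y\<in>lattice_nbrs z. K)"
      by (rule sum_mono)
    also have "\<dots> = 2 * real CARD('d) * K"
      by (simp add: card_lattice_nbrs)
    finally have "V z + (\<Sum>y\<in>lattice_nbrs z. exp (s * (g y - g z)) - 1) \<le>
        h + max 0 (real (l1 z) - 2 * real (card H)) * b + 2 * real CARD('d) * K"
      using rest[OF False] by (simp add: b_def)
    also have "max 0 (real (l1 z) - 2 * real (card H)) * b \<le> real (D z) * b"
      using D_ge[of z] b by (intro mult_right_mono) auto
    finally show ?thesis
      using h by (simp add: g_def)
  qed
  have g: "g z \<le> A + b * real (l1 z)" for z
  proof -
    have "b * real (D z) \<le> b * real (l1 z)"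
      using b collapsed_le by (intro mult_left_mono) (auto simp: D_def)
    then show ?thesis
      by (simp add: g_def mult.commute)
  qed
  have A: "0 \<le> A"
    using h K mult_nonneg_nonneg[of "2 * real CARD('d)" K] by linarith
  show "(u t) summable_on UNIV"
    using total_mass_upper_bound(1)[OF u V t super g A b(1)] .
  have "g 0 = A"
    by (simp add: g_def D_def)
  then show "total_mass u t \<le> 2 * exp (t * A)"
    using total_mass_upper_bound(2)[OF u V t super g A b(1)] by simp
qed

section \<open>Lower bound by a single site\<close>

text \<open>The walk stays at \<open>z\<close> for time \<open>\<tau>\<close>.\<close>

lemma pam_growth_at_site:
  fixes V :: "int ^ 'd \<Rightarrow> real"
  assumes u: "pam_solution V u" and s: "0 \<le> s" and \<tau>: "0 \<le> \<tau>"
  shows "exp ((V z - 2 * real CARD('d)) * \<tau>) * u s z \<le> u (s + \<tau>) z"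
proof -
  define c where "c = V z - 2 * real CARD('d)"
  define h where "h r = exp (- (c * r)) * u (s + r) z" for r
  have "h 0 \<le> h \<tau>"
  proof (rule DERIV_nonneg_imp_increasing_open[where f = h])
    fix r assume r: "0 < r" "r < \<tau>"
    have e': "((\<lambda>r. exp (- (c * r))) has_real_derivative exp (- (c * r)) * (- c)) (at r)"
      by (auto intro!: derivative_eq_intros)
    have u': "((\<lambda>r. u (s + r) z) has_real_derivative
        (discrete_laplacian (u (s + r)) z + V z * u (s + r) z)) (at r)"
      using pam_deriv[OF u, of "r + s" z] r s DERIV_shift[of "\<lambda>s. u s z" _ r s]
      by (simp add: add.commute)
    have "(h has_real_derivative exp (- (c * r)) * (\<Sum>y\<in>lattice_nbrs z. u (s + r) y)) (at r)"
      unfolding h_def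
      by (rule DERIV_cong[OF DERIV_mult[OF e' u']]) (simp add: laplacian_eq c_def algebra_simps)
    moreover have "0 \<le> exp (- (c * r)) * (\<Sum>y\<in>lattice_nbrs z. u (s + r) y)"
      using pam_nonneg[OF u] r s by (intro mult_nonneg_nonneg sum_nonneg) auto
    ultimately show "\<exists>y. (h has_real_derivative y) (at r) \<and> 0 \<le> y"
      by blast
  next
    have "continuous_on {0..\<tau>} (\<lambda>r. u (s + r) z)"
      by (rule continuous_on_compose2[OF pam_continuous[OF u, of "s + \<tau>" z]])
        (use s in \<open>auto intro!: continuous_intros\<close>)
    then show "continuous_on {0..\<tau>} h"
      unfolding h_def by (intro continuous_intros)
  qed (use \<tau> in auto)
  then have "exp (c * \<tau>) * h 0 \<le> exp (c * \<tau>) * h \<tau>"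
    by (rule mult_left_mono) simp
  then show ?thesis
    by (simp add: h_def c_def flip: mult.assoc exp_add)
qed

text \<open>The walk moves to \<open>z\<close> during \<open>[0, n/A]\<close>, which costs a factor \<open>(n/A)\<^sup>n / n! \<ge> A\<^sup>-\<^sup>n\<close>, and stays
  there until time \<open>t\<close>.\<close>

lemma ln_total_mass_lower_bound:
  fixes V :: "int ^ 'd \<Rightarrow> real"
  assumes u: "pam_solution V u" and V: "\<And>z. 0 \<le> V z" and t: "0 < t" and A: "0 < A"
    and z: "real (l1 z) \<le> t * A" and summ: "(u t) summable_on UNIV"
  shows "(t - real (l1 z) / A) * V z - real (l1 z) * ln A - 2 * real CARD('d) * t \<le> ln (total_mass u t)"
proof -
  let ?d = "real CARD('d)"
  define n where "n = l1 z"
  define s where "s = real n / A"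
  have s: "0 \<le> s" "s \<le> t"
    using A z by (auto simp: s_def n_def divide_simps mult.commute)
  have "1 / A ^ n \<le> s ^ n / fact n"
  proof -
    have "(fact n :: real) \<le> real n ^ n"
      using fact_le_power[of n, where 'a = real] by (simp only: of_nat_power)
    then show ?thesis
      using A by (simp add: s_def power_divide divide_simps)
  qed
  also have "s ^ n / fact n \<le> exp (2 * ?d * s) * u s z"
    using pam_path_lower_bound[OF u V _ s(1), of 0 z 0] pam_initial[OF u, of 0] by (simp add: n_def)
  finally have 1: "1 / A ^ n \<le> exp (2 * ?d * s) * u s z" .
  have "exp ((V z - 2 * ?d) * (t - s)) * exp (- (2 * ?d * s)) * (1 / A ^ n) \<le>
      exp ((V z - 2 * ?d) * (t - s)) * exp (- (2 * ?d * s)) * (exp (2 * ?d * s) * u s z)"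
    by (rule mult_left_mono[OF 1]) simp
  also have "\<dots> = exp ((V z - 2 * ?d) * (t - s)) * u s z"
    by (simp add: exp_minus)
  also have "\<dots> \<le> u t z"
    using pam_growth_at_site[OF u s(1), of "t - s" z] s by simp
  also have "u t z \<le> total_mass u t"
    unfolding total_mass_def
    using infsum_mono_neutral[of "u t" "{z}" "u t" UNIV] summ pam_nonneg[OF u, of t] t by simp
  finally have 2: "exp ((V z - 2 * ?d) * (t - s)) * exp (- (2 * ?d * s)) * (1 / A ^ n) \<le> total_mass u t" .
  have "exp ((t - s) * V z - real n * ln A - 2 * ?d * t) =
      exp ((V z - 2 * ?d) * (t - s)) * exp (- (2 * ?d * s)) * (1 / A ^ n)"
  proof -
    have "1 / A ^ n = exp (- (real n * ln A))"
      using A by (simp add: exp_minus exp_of_nat_mult inverse_eq_divide)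
    then show ?thesis
      by (simp add: algebra_simps flip: exp_add)
  qed
  with 2 have 3: "exp ((t - s) * V z - real n * ln A - 2 * ?d * t) \<le> total_mass u t"
    by simp
  then have "0 < total_mass u t"
    using exp_gt_zero order_less_le_trans by blast
  with 3 show ?thesis
    by (simp add: ln_ge_iff s_def n_def)
qed


section \<open>Lattice sums\<close>

lemma exp_l1_prod: "exp (- (\<mu> * real (l1 (z :: int ^ 'd)))) = (\<Prod>i\<in>UNIV. exp (- (\<mu> * real_of_int \<bar>z $ i\<bar>)))"
proof -
  have "real (l1 z) = (\<Sum>i\<in>UNIV. real_of_int \<bar>z $ i\<bar>)"
    by (simp add: l1_def)
  then show ?thesis
    by (simp add: sum_distrib_left exp_sum flip: sum_negf)
qed

lemma sum_symmetric_interval: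
  fixes f :: "nat \<Rightarrow> real"
  shows "(\<Sum>k\<in>{- int m..int m}. f (nat \<bar>k\<bar>)) = f 0 + 2 * (\<Sum>k=1..m. f k)"
proof (induction m)
  case 0
  then show ?case by simp
next
  case (Suc m)
  have "{- int (Suc m)..int (Suc m)} = insert (int (Suc m)) (insert (- int (Suc m)) {- int m..int m})"
    by auto
  then have "(\<Sum>k\<in>{- int (Suc m)..int (Suc m)}. f (nat \<bar>k\<bar>)) =
      2 * f (Suc m) + (\<Sum>k\<in>{- int m..int m}. f (nat \<bar>k\<bar>))"
    by (simp add: nat_add_distrib)
  with Suc show ?case
    by simp
qed

lemma sum_exp_interval:
  assumes "0 < \<mu>"
  shows "(\<Sum>k\<in>{- int m..int m}. exp (- (\<mu> * real_of_int \<bar>k\<bar>))) =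
    (1 + exp (- \<mu>) - 2 * exp (- \<mu>) * exp (- (\<mu> * real m))) / (1 - exp (- \<mu>))"
proof -
  define q where "q = exp (- \<mu>)"
  have q: "q \<noteq> 1" "q < 1"
    using assms by (auto simp: q_def)
  have qk: "q ^ k = exp (- (\<mu> * real k))" for k
    by (simp add: q_def mult.commute flip: exp_of_nat_mult)
  have "(\<Sum>k\<in>{- int m..int m}. exp (- (\<mu> * real_of_int \<bar>k\<bar>))) = (\<Sum>k\<in>{- int m..int m}. q ^ nat \<bar>k\<bar>)"
    by (simp add: qk)
  also have "\<dots> = 1 + 2 * (\<Sum>k=1..m. q ^ k)"
    by (subst sum_symmetric_interval) simp
  also have "(\<Sum>k=1..m. q ^ k) = (q - q ^ Suc m) / (1 - q)"
  proof -
    have "(1 - q) * (\<Sum>k=1..m. q ^ k) = q - q ^ Suc m"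
      by (induction m) (simp_all add: distrib_left left_diff_distrib)
    then show ?thesis
      using q by (simp add: eq_divide_eq mult.commute)
  qed
  also have "1 + 2 * ((q - q ^ Suc m) / (1 - q)) = (1 + q - 2 * q * q ^ m) / (1 - q)"
    using q by (simp add: field_simps)
  finally show ?thesis
    unfolding qk by (simp add: q_def)
qed

text \<open>The sum over the cube is the \<open>d\<close>-th power of a geometric sum over an interval, and
  \<open>\<Sum>\<^bsub>k\<in>\<int>\<^esub> exp (- \<mu> \<bar>k\<bar>) \<sim> 2 / \<mu>\<close> as \<open>\<mu> \<rightarrow> 0\<close>. The condition on \<open>m\<close> says that the cube exceeds the
  decay length.\<close>

lemma tendsto_cube_sum:
  fixes \<mu> :: "real \<Rightarrow> real" and m :: "real \<Rightarrow> nat"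
  assumes \<mu>: "filterlim \<mu> (at_right 0) at_top"
    and m: "filterlim (\<lambda>t. \<mu> t * real (m t)) at_top at_top"
  shows "((\<lambda>t. \<mu> t ^ CARD('d) * (\<Sum>z\<in>cube (m t). exp (- (\<mu> t * real (l1 (z :: int ^ 'd)))))) \<longlongrightarrow> 2 ^ CARD('d)) at_top"
proof -
  have pos: "\<forall>\<^sub>F t in at_top. 0 < \<mu> t"
    using \<mu> by (auto simp: filterlim_at elim: eventually_mono)
  have e: "((\<lambda>t. exp (- (\<mu> t * real (m t)))) \<longlongrightarrow> 0) at_top"
  proof (rule filterlim_compose[OF _ m])
    show "((\<lambda>x::real. exp (- x)) \<longlongrightarrow> 0) at_top"
      by real_asymp
  qed
  have e1: "((\<lambda>t. exp (- \<mu> t)) \<longlongrightarrow> 1) at_top"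
  proof (rule filterlim_compose[OF _ \<mu>])
    show "((\<lambda>x::real. exp (- x)) \<longlongrightarrow> 1) (at_right 0)"
      by real_asymp
  qed
  have e2: "((\<lambda>t. \<mu> t / (1 - exp (- \<mu> t))) \<longlongrightarrow> 1) at_top"
  proof (rule filterlim_compose[OF _ \<mu>])
    show "((\<lambda>x::real. x / (1 - exp (- x))) \<longlongrightarrow> 1) (at_right 0)"
      by real_asymp
  qed
  have "((\<lambda>t. \<mu> t / (1 - exp (- \<mu> t)) * (1 + exp (- \<mu> t) - 2 * exp (- \<mu> t) * exp (- (\<mu> t * real (m t)))))
      \<longlongrightarrow> 1 * (1 + 1 - 2 * 1 * 0)) at_top"
    by (intro tendsto_intros e e1 e2)
  then have "((\<lambda>t. (\<mu> t / (1 - exp (- \<mu> t)) * (1 + exp (- \<mu> t) - 2 * exp (- \<mu> t) * exp (- (\<mu> t * real (m t))))) ^ CARD('d))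
      \<longlongrightarrow> 2 ^ CARD('d)) at_top"
    by (intro tendsto_power) simp
  then show ?thesis
  proof (rule Lim_transform_eventually)
    show "\<forall>\<^sub>F t in at_top.
      (\<mu> t / (1 - exp (- \<mu> t)) * (1 + exp (- \<mu> t) - 2 * exp (- \<mu> t) * exp (- (\<mu> t * real (m t))))) ^ CARD('d) =
      \<mu> t ^ CARD('d) * (\<Sum>z\<in>cube (m t). exp (- (\<mu> t * real (l1 (z :: int ^ 'd)))))"
      using pos
    proof eventually_elim
      case (elim t)
      have "(\<Sum>z\<in>cube (m t). exp (- (\<mu> t * real (l1 (z :: int ^ 'd))))) =
          (\<Sum>k\<in>{- int (m t)..int (m t)}. exp (- (\<mu> t * real_of_int \<bar>k\<bar>))) ^ CARD('d)"
        unfolding exp_l1_prod by (rule sum_cube_prod)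
      then show ?case
        using sum_exp_interval[OF elim, of "m t"] by (simp add: power_mult_distrib power_divide)
    qed
  qed
qed

lemma sum_inverse_squares_le: "(\<Sum>k=1..m. 1 / (1 + real k)\<^sup>2) \<le> 1 - 1 / (1 + real m)"
proof (induction m)
  case 0
  then show ?case by simp
next
  case (Suc m)
  have "1 / (1 + real (Suc m))\<^sup>2 \<le> 1 / (1 + real m) - 1 / (1 + real (Suc m))"
    by (simp add: divide_simps power2_eq_square)
  with Suc show ?case
    by simp
qed

text \<open>A crude polynomial bound suffices: it will be multiplied by a factor \<open>exp (- r)\<close> that is
  much smaller. The summand is dominated by a multiple of \<open>(1 + \<bar>z\<bar>/t)\<^bsup>-2d\<^esup>\<close>, hence of
  \<open>t\<^bsup>2d\<^esup> \<Prod>\<^sub>i (1 + \<bar>z\<^sub>i\<bar>)\<^sup>-\<^sup>2\<close>, which is summable.\<close>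

lemma stretched_exp_sum_bound:
  fixes \<gamma> :: real
  assumes \<gamma>: "0 < \<gamma>"
  obtains C where "0 < C" and "\<And>t F. 1 \<le> t \<Longrightarrow> finite F \<Longrightarrow>
    (\<Sum>z\<in>F. exp (- ((real (l1 (z :: int ^ 'd)) / t) powr \<gamma> / 2))) \<le> C * t ^ (2 * CARD('d))"
proof -
  let ?n = "CARD('d)"
  have "((\<lambda>w. (1 + w) ^ (2 * ?n) * exp (- (w powr \<gamma> / 2))) \<longlongrightarrow> 0) at_top"
    using \<gamma> by real_asymp
  then have "\<forall>\<^sub>F w in at_top. (1 + w) ^ (2 * ?n) * exp (- (w powr \<gamma> / 2)) < 1"
    by (rule order_tendstoD) simp
  then obtain W where W: "\<And>w. w \<ge> W \<Longrightarrow> (1 + w) ^ (2 * ?n) * exp (- (w powr \<gamma> / 2)) < 1"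
    by (auto simp: eventually_at_top_linorder)
  define C where "C = (1 + \<bar>W\<bar>) ^ (2 * ?n)"
  have C: "1 \<le> C"
    by (simp add: C_def)
  have CW: "(1 + w) ^ (2 * ?n) * exp (- (w powr \<gamma> / 2)) \<le> C" if "0 \<le> w" for w
  proof (cases "w \<ge> W")
    case True
    with W[of w] C show ?thesis by linarith
  next
    case False
    then have "(1 + w) ^ (2 * ?n) \<le> C"
      using that unfolding C_def by (intro power_mono) auto
    moreover have "(1 + w) ^ (2 * ?n) * exp (- (w powr \<gamma> / 2)) \<le> (1 + w) ^ (2 * ?n) * 1"
      using that by (intro mult_left_mono) auto
    ultimately show ?thesis
      by linarith
  qed
  have bound: "exp (- ((real (l1 z) / t) powr \<gamma> / 2)) \<le> C * t ^ (2 * ?n) * (\<Prod>i\<in>UNIV. 1 / (1 + real (nat \<bar>z $ i\<bar>))\<^sup>2)"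
    if t: "1 \<le> t" for t and z :: "int ^ 'd"
  proof -
    define w where "w = real (l1 z) / t"
    have w: "0 \<le> w"
      using t by (simp add: w_def)
    have "(\<Prod>i\<in>UNIV. (1 + real (nat \<bar>z $ i\<bar>))\<^sup>2) \<le> (\<Prod>i\<in>(UNIV::'d set). (t * (1 + w))\<^sup>2)"
    proof (intro prod_mono conjI power_mono)
      fix i
      have "1 + real (nat \<bar>z $ i\<bar>) \<le> 1 + real (l1 z)"
        using l1_component[of z i] by simp
      also have "\<dots> \<le> t * (1 + w)"
        using t by (simp add: w_def algebra_simps)
      finally show "1 + real (nat \<bar>z $ i\<bar>) \<le> t * (1 + w)" .
    qed auto
    also have "\<dots> = t ^ (2 * ?n) * (1 + w) ^ (2 * ?n)"
      by (simp add: power_mult power_mult_distrib)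
    finally have "(\<Prod>i\<in>UNIV. (1 + real (nat \<bar>z $ i\<bar>))\<^sup>2) * exp (- (w powr \<gamma> / 2)) \<le>
        t ^ (2 * ?n) * ((1 + w) ^ (2 * ?n) * exp (- (w powr \<gamma> / 2)))"
      by (simp add: mult_right_mono flip: mult.assoc)
    also have "\<dots> \<le> t ^ (2 * ?n) * C"
      using CW[OF w] t by (intro mult_left_mono) auto
    finally have *: "(\<Prod>i\<in>UNIV. (1 + real (nat \<bar>z $ i\<bar>))\<^sup>2) * exp (- (w powr \<gamma> / 2)) \<le> t ^ (2 * ?n) * C" .
    have "0 < (\<Prod>i\<in>UNIV. (1 + real (nat \<bar>z $ i\<bar>))\<^sup>2)"
      by (intro prod_pos) (auto intro!: zero_less_power add_pos_nonneg)
    with * show ?thesis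
      by (simp add: prod_dividef w_def pos_le_divide_eq mult.commute)
  qed
  have "(\<Sum>z\<in>F. exp (- ((real (l1 (z :: int ^ 'd)) / t) powr \<gamma> / 2))) \<le> (C * 3 ^ ?n) * t ^ (2 * ?n)"
    if t: "1 \<le> t" and F: "finite F" for t and F :: "(int ^ 'd) set"
  proof -
    define m where "m = Max (insert 0 (l1 ` F))"
    have "F \<subseteq> cube m"
      using F by (intro subsetI l1_ball_subset_cube) (auto simp: m_def)
    then have "(\<Sum>z\<in>F. exp (- ((real (l1 z) / t) powr \<gamma> / 2))) \<le>
        (\<Sum>z\<in>cube m. exp (- ((real (l1 (z :: int ^ 'd)) / t) powr \<gamma> / 2)))"
      by (intro sum_mono2) auto
    also have "\<dots> \<le> (\<Sum>z\<in>cube m. C * t ^ (2 * ?n) * (\<Prod>i\<in>UNIV. 1 / (1 + real (nat \<bar>(z :: int ^ 'd) $ i\<bar>))\<^sup>2))"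
      using t by (intro sum_mono bound)
    also have "\<dots> = C * t ^ (2 * ?n) * (\<Sum>k\<in>{- int m..int m}. 1 / (1 + real (nat \<bar>k\<bar>))\<^sup>2) ^ ?n"
      unfolding sum_distrib_left[symmetric]
      by (subst sum_cube_prod[of "\<lambda>k. 1 / (1 + real (nat \<bar>k\<bar>))\<^sup>2"]) (rule refl)
    also have "(\<Sum>k\<in>{- int m..int m}. 1 / (1 + real (nat \<bar>k\<bar>))\<^sup>2) = 1 + 2 * (\<Sum>k=1..m. 1 / (1 + real k)\<^sup>2)"
      using sum_symmetric_interval[of "\<lambda>k. 1 / (1 + real k)\<^sup>2" m] by simp
    also have "C * t ^ (2 * ?n) * (1 + 2 * (\<Sum>k=1..m. 1 / (1 + real k)\<^sup>2)) ^ ?n \<le> C * t ^ (2 * ?n) * 3 ^ ?n"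
    proof (intro mult_left_mono power_mono)
      have "0 \<le> 1 / (1 + real m)"
        by simp
      then show "1 + 2 * (\<Sum>k=1..m. 1 / (1 + real k)\<^sup>2) \<le> 3"
        using sum_inverse_squares_le[of m] by linarith
      show "0 \<le> 1 + 2 * (\<Sum>k=1..m. 1 / (1 + real k)\<^sup>2)"
        by (intro add_nonneg_nonneg mult_nonneg_nonneg sum_nonneg) auto
    qed (use C t in auto)
    finally show ?thesis
      by (simp add: mult_ac)
  qed
  moreover have "0 < C * 3 ^ ?n"
    using C by simp
  ultimately show thesis
    using that by blast
qed

section \<open>Asymptotics of the levels\<close>

text \<open>The scale of the fluctuations; \<open>level \<gamma> d y 0 t\<close> below is the value of \<open>L\<^sub>t\<close> for which the
  normalised variable equals \<open>y\<close>. The parameter \<open>e\<close> absorbs the bounded errors of the estimates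
  of the total mass.\<close>

definition scale :: "real \<Rightarrow> real \<Rightarrow> real \<Rightarrow> real" where
  "scale \<gamma> d t = (d * ln t) powr (1 / \<gamma> - 1)"

definition level :: "real \<Rightarrow> real \<Rightarrow> real \<Rightarrow> real \<Rightarrow> real \<Rightarrow> real" where
  "level \<gamma> d y e t = (d * ln t) powr (1 / \<gamma>) + d * (1 / \<gamma>\<^sup>2 - 1 / \<gamma>) * scale \<gamma> d t * ln (ln t)
     - d / \<gamma> * scale \<gamma> d t * ln (ln (ln t)) + y * scale \<gamma> d t + e"

text \<open>The relative deviation of the level from its leading term \<open>(d x)\<^bsup>1/\<gamma>\<^esup>\<close>, as a function of
  \<open>x = ln t\<close>. It is of order \<open>ln x / x\<close>, so that its square does not contribute to the limit of
  \<open>level\<^sup>\<gamma>\<close>.\<close>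

definition rel_excess :: "real \<Rightarrow> real \<Rightarrow> real \<Rightarrow> real \<Rightarrow> real \<Rightarrow> real" where
  "rel_excess \<gamma> d y e x = (d * (1 / \<gamma>\<^sup>2 - 1 / \<gamma>) * ln x - d / \<gamma> * ln (ln x) + y
      + e * (d * x) powr (1 - 1 / \<gamma>)) / (d * x)"

lemma ln_large: "\<forall>\<^sub>F t :: real in at_top. B < ln t"
  by (rule filterlim_at_top_dense[THEN iffD1, OF ln_at_top, rule_format])

lemma ln_ln_large: "\<forall>\<^sub>F t :: real in at_top. B < ln (ln t)"
  by (rule filterlim_at_top_dense[THEN iffD1, OF filterlim_compose[OF ln_at_top ln_at_top], rule_format])

context
  fixes \<gamma> d :: real
  assumes \<gamma>: "0 < \<gamma>" "\<gamma> < 1" and d: "0 < d"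
begin

lemma level_eq:
  assumes "0 < ln t"
  shows "level \<gamma> d y e t = (d * ln t) powr (1 / \<gamma>) * (1 + rel_excess \<gamma> d y e (ln t))"
proof -
  define X where "X = d * ln t"
  have X: "0 < X"
    using assms d by (simp add: X_def)
  have s: "X powr (1 / \<gamma>) / X = scale \<gamma> d t"
    using X by (simp add: scale_def X_def[symmetric] powr_diff)
  define E where "E = X powr (1 - 1 / \<gamma>)"
  have E: "scale \<gamma> d t * E = 1"
    using X by (simp add: E_def scale_def X_def[symmetric] flip: powr_add)
  define c\<^sub>1 c\<^sub>2 where "c\<^sub>1 = d * (1 / \<gamma>\<^sup>2 - 1 / \<gamma>)" and "c\<^sub>2 = d / \<gamma>"
  define N where "N = c\<^sub>1 * ln (ln t) - c\<^sub>2 * ln (ln (ln t)) + y + e * E"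
  have "scale \<gamma> d t * N = c\<^sub>1 * scale \<gamma> d t * ln (ln t) - c\<^sub>2 * scale \<gamma> d t * ln (ln (ln t)) + y * scale \<gamma> d t + e * (scale \<gamma> d t * E)"
    by (simp add: N_def algebra_simps)
  then have "level \<gamma> d y e t = X powr (1 / \<gamma>) + scale \<gamma> d t * N"
    unfolding E by (simp add: level_def c\<^sub>1_def c\<^sub>2_def X_def)
  also have "scale \<gamma> d t * N = X powr (1 / \<gamma>) * (N / X)"
    by (simp flip: s)
  also have "N / X = rel_excess \<gamma> d y e (ln t)"
    by (simp add: rel_excess_def N_def E_def X_def c\<^sub>1_def c\<^sub>2_def)
  finally show ?thesis
    by (simp add: X_def distrib_left)
qed

lemma rel_excess_tendsto: "((\<lambda>t. rel_excess \<gamma> d y e (ln t)) \<longlongrightarrow> 0) at_top"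
proof (rule filterlim_compose[OF _ ln_at_top])
  have lim: "((\<lambda>x. (c1 * ln x - c2 * ln (ln x) + y + e * (d * x) powr (1 - p)) / (d * x)) \<longlongrightarrow> 0) at_top"
    if "1 < p" "0 < c1" "0 < c2" for p c1 c2 :: real
    using that d by real_asymp
  have "1 < 1 / \<gamma>" "0 < d / \<gamma>" "0 < d * (1 / \<gamma>\<^sup>2 - 1 / \<gamma>)"
    using \<gamma> d by (auto simp: field_simps power2_eq_square)
  then show "(rel_excess \<gamma> d y e \<longlongrightarrow> 0) at_top"
    unfolding rel_excess_def by (intro lim)
qed

lemma rel_excess_pos: "\<forall>\<^sub>F t in at_top. 0 < 1 + rel_excess \<gamma> d y e (ln t)"
proof -
  have "\<forall>\<^sub>F t in at_top. -1 < rel_excess \<gamma> d y e (ln t)"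
    using order_tendstoD(1)[OF rel_excess_tendsto, of "-1"] by simp
  then show ?thesis
    by eventually_elim simp
qed

lemma level_powr_eq:
  "\<forall>\<^sub>F t in at_top. level \<gamma> d y e t powr q = (d * ln t) powr (q / \<gamma>) * (1 + rel_excess \<gamma> d y e (ln t)) powr q"
  using ln_large[of 0] rel_excess_pos[of y e]
proof eventually_elim
  case (elim t)
  then show ?case
    using d by (simp add: level_eq powr_mult powr_powr)
qed

lemma level_powr_ratio:
  "((\<lambda>t. level \<gamma> d y e t powr q / ln t powr (q / \<gamma>)) \<longlongrightarrow> d powr (q / \<gamma>)) at_top"
proof -
  have "((\<lambda>t. d powr (q / \<gamma>) * (1 + rel_excess \<gamma> d y e (ln t)) powr q) \<longlongrightarrow> d powr (q / \<gamma>) * (1 + 0) powr q) at_top"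
    by (intro tendsto_intros rel_excess_tendsto) auto
  then have "((\<lambda>t. d powr (q / \<gamma>) * (1 + rel_excess \<gamma> d y e (ln t)) powr q) \<longlongrightarrow> d powr (q / \<gamma>)) at_top"
    by simp
  then show ?thesis
  proof (rule Lim_transform_eventually)
    show "\<forall>\<^sub>F t in at_top. d powr (q / \<gamma>) * (1 + rel_excess \<gamma> d y e (ln t)) powr q =
        level \<gamma> d y e t powr q / ln t powr (q / \<gamma>)"
      using ln_large[of 0] level_powr_eq[of y e q]
    proof eventually_elim
      case (elim t)
      then show ?case
        using d by (simp add: powr_mult)
    qed
  qed
qed

lemma level_pos: "\<forall>\<^sub>F t in at_top. 0 < level \<gamma> d y e t"
  using ln_large[of 0] rel_excess_pos[of y e]
proof eventually_elim
  case (elim t)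
  then show ?case
    using d by (simp add: level_eq)
qed

lemma level_ratio: "((\<lambda>t. level \<gamma> d y e t / ln t powr (1 / \<gamma>)) \<longlongrightarrow> d powr (1 / \<gamma>)) at_top"
  using level_powr_ratio[of y e 1]
proof (rule Lim_transform_eventually)
  show "\<forall>\<^sub>F t in at_top. level \<gamma> d y e t powr 1 / ln t powr (1 / \<gamma>) = level \<gamma> d y e t / ln t powr (1 / \<gamma>)"
    using level_pos[of y e] by eventually_elim simp
qed

lemma ln_level_ratio: "((\<lambda>t. ln (level \<gamma> d y e t) / ln (ln t)) \<longlongrightarrow> 1 / \<gamma>) at_top"
proof -
  have "((\<lambda>t. ln (level \<gamma> d y e t / ln t powr (1 / \<gamma>)) * (1 / ln (ln t)) + 1 / \<gamma>) \<longlongrightarrow> ln (d powr (1 / \<gamma>)) * 0 + 1 / \<gamma>) at_top"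
  proof (intro tendsto_intros level_ratio)
    show "((\<lambda>t::real. 1 / ln (ln t)) \<longlongrightarrow> 0) at_top"
      by real_asymp
  qed (use d in auto)
  then have "((\<lambda>t. ln (level \<gamma> d y e t / ln t powr (1 / \<gamma>)) * (1 / ln (ln t)) + 1 / \<gamma>) \<longlongrightarrow> 1 / \<gamma>) at_top"
    by simp
  then show ?thesis
  proof (rule Lim_transform_eventually)
    show "\<forall>\<^sub>F t in at_top. ln (level \<gamma> d y e t / ln t powr (1 / \<gamma>)) * (1 / ln (ln t)) + 1 / \<gamma> = ln (level \<gamma> d y e t) / ln (ln t)"
      using ln_large[of 0] ln_ln_large[of 0] level_pos[of y e]
    proof eventually_elim
      case (elim t)
      then have "ln (level \<gamma> d y e t / ln t powr (1 / \<gamma>)) = ln (level \<gamma> d y e t) - 1 / \<gamma> * ln (ln t)"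
        by (simp add: ln_div ln_powr)
      then show ?case
        using elim by (simp add: left_diff_distrib diff_divide_distrib)
    qed
  qed
qed

text \<open>First-order expansion of \<open>d x (1 + \<delta>)\<^sup>\<gamma>\<close> with \<open>\<delta>\<close> the relative excess. The shift \<open>e\<close> disappears,
  since it contributes \<open>O(x\<^bsup>1-1/\<gamma>\<^esup>)\<close> with a negative exponent.\<close>

lemma level_powr_tendsto:
  "((\<lambda>t. level \<gamma> d y e t powr \<gamma> - (d * ln t + d * (1 / \<gamma> - 1) * ln (ln t) - d * ln (ln (ln t)))) \<longlongrightarrow> \<gamma> * y) at_top"
proof -
  have lim: "((\<lambda>x. d * x * ((1 + (c1 * ln x - c2 * ln (ln x) + y + e * (d * x) powr (1 - p)) / (d * x)) powr \<gamma> - 1)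
      - \<gamma> * c1 * ln x + \<gamma> * c2 * ln (ln x)) \<longlongrightarrow> \<gamma> * y) at_top"
    if "1 < p" "0 < c1" "0 < c2" for p c1 c2 :: real
    using that d \<gamma> by real_asymp
  have "1 < 1 / \<gamma>" "0 < d / \<gamma>" "0 < d * (1 / \<gamma>\<^sup>2 - 1 / \<gamma>)"
    using \<gamma> d by (auto simp: field_simps power2_eq_square)
  then have "((\<lambda>x. d * x * ((1 + rel_excess \<gamma> d y e x) powr \<gamma> - 1) - \<gamma> * (d * (1 / \<gamma>\<^sup>2 - 1 / \<gamma>)) * ln x
      + \<gamma> * (d / \<gamma>) * ln (ln x)) \<longlongrightarrow> \<gamma> * y) at_top"
    unfolding rel_excess_def by (intro lim)
  then have "((\<lambda>t. d * ln t * ((1 + rel_excess \<gamma> d y e (ln t)) powr \<gamma> - 1) - \<gamma> * (d * (1 / \<gamma>\<^sup>2 - 1 / \<gamma>)) * ln (ln t)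
      + \<gamma> * (d / \<gamma>) * ln (ln (ln t))) \<longlongrightarrow> \<gamma> * y) at_top"
    by (rule filterlim_compose) (rule ln_at_top)
  then show ?thesis
  proof (rule Lim_transform_eventually)
    show "\<forall>\<^sub>F t in at_top. d * ln t * ((1 + rel_excess \<gamma> d y e (ln t)) powr \<gamma> - 1)
        - \<gamma> * (d * (1 / \<gamma>\<^sup>2 - 1 / \<gamma>)) * ln (ln t) + \<gamma> * (d / \<gamma>) * ln (ln (ln t)) =
        level \<gamma> d y e t powr \<gamma> - (d * ln t + d * (1 / \<gamma> - 1) * ln (ln t) - d * ln (ln (ln t)))"
      using ln_large[of 0] level_powr_eq[of y e \<gamma>]
    proof eventually_elim
      case (elim t)
      have "\<gamma> * (d * (1 / \<gamma>\<^sup>2 - 1 / \<gamma>)) = d * (1 / \<gamma> - 1)" "\<gamma> * (d / \<gamma>) = d"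
        using \<gamma> by (auto simp: power2_eq_square field_simps)
      moreover have "level \<gamma> d y e t powr \<gamma> = d * ln t * (1 + rel_excess \<gamma> d y e (ln t)) powr \<gamma>"
        using elim d \<gamma> by simp
      ultimately show ?case
        by (simp add: algebra_simps)
    qed
  qed
qed

lemma level_powr_ge: "\<forall>\<^sub>F t in at_top. d * ln t \<le> level \<gamma> d y e t powr \<gamma>"
proof -
  have "1 < 1 / \<gamma>"
    using \<gamma> by simp
  then have "filterlim (\<lambda>t. d * (1 / \<gamma> - 1) * ln (ln t) - d * ln (ln (ln t))) at_top at_top"
    using d by real_asymp
  then have "filterlim (\<lambda>t. level \<gamma> d y e t powr \<gamma> -
      (d * ln t + d * (1 / \<gamma> - 1) * ln (ln t) - d * ln (ln (ln t))) +
      (d * (1 / \<gamma> - 1) * ln (ln t) - d * ln (ln (ln t)))) at_top at_top"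
    by (rule filterlim_tendsto_add_at_top[OF level_powr_tendsto])
  then have "\<forall>\<^sub>F t in at_top. 0 \<le> level \<gamma> d y e t powr \<gamma> -
      (d * ln t + d * (1 / \<gamma> - 1) * ln (ln t) - d * ln (ln (ln t))) +
      (d * (1 / \<gamma> - 1) * ln (ln t) - d * ln (ln (ln t)))"
    unfolding filterlim_at_top by blast
  then show ?thesis
    by eventually_elim linarith
qed

end


section \<open>The expected number of good sites\<close>

lemma powr_increment:
  fixes \<gamma> A x :: real
  assumes "0 < A" "0 \<le> x"
  obtains \<xi> where "A \<le> \<xi>" "\<xi> \<le> A + x" "(A + x) powr \<gamma> = A powr \<gamma> + \<gamma> * \<xi> powr (\<gamma> - 1) * x"
proof (cases "x = 0")
  case True
  then show ?thesis
    using that[of A] by simp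
next
  case False
  have "\<exists>\<xi>>A. \<xi> < A + x \<and> (A + x) powr \<gamma> - A powr \<gamma> = (A + x - A) * (\<gamma> * \<xi> powr (\<gamma> - 1))"
  proof (rule MVT2)
    show "A < A + x"
      using assms False by simp
    show "((\<lambda>x. x powr \<gamma>) has_real_derivative \<gamma> * \<xi> powr (\<gamma> - 1)) (at \<xi>)" if "A \<le> \<xi>" for \<xi>
      using that assms by (intro DERIV_fun_powr[OF DERIV_ident, THEN DERIV_cong]) auto
  qed
  then obtain \<xi> where "A < \<xi>" "\<xi> < A + x" "(A + x) powr \<gamma> - A powr \<gamma> = x * (\<gamma> * \<xi> powr (\<gamma> - 1))"
    by auto
  then show ?thesis
    using that[of \<xi>] by (simp add: algebra_simps)
qed

lemma powr_tangent_above: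
  fixes \<gamma> A x :: real
  assumes "0 < \<gamma>" "\<gamma> < 1" "0 < A" "0 \<le> x"
  shows "(A + x) powr \<gamma> \<le> A powr \<gamma> + \<gamma> * A powr (\<gamma> - 1) * x"
proof -
  obtain \<xi> where \<xi>: "A \<le> \<xi>" "(A + x) powr \<gamma> = A powr \<gamma> + \<gamma> * \<xi> powr (\<gamma> - 1) * x"
    using powr_increment assms by metis
  have "\<xi> powr (\<gamma> - 1) \<le> A powr (\<gamma> - 1)"
    using \<xi> assms by (intro powr_mono2') auto
  then show ?thesis
    unfolding \<xi> using assms by (intro add_left_mono mult_right_mono mult_left_mono) auto
qed

text \<open>The derivative of the power function decreases, so that on \<open>[A, (1 + \<eta>) A]\<close> it is at least
  its value at the right end point.\<close>

lemma powr_chord_below: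
  fixes \<gamma> A x \<eta> :: real
  assumes "0 < \<gamma>" "\<gamma> < 1" "0 < A" "0 \<le> x" "x \<le> \<eta> * A"
  shows "A powr \<gamma> + \<gamma> * ((1 + \<eta>) powr (\<gamma> - 1) * A powr (\<gamma> - 1)) * x \<le> (A + x) powr \<gamma>"
proof -
  obtain \<xi> where \<xi>: "A \<le> \<xi>" "\<xi> \<le> A + x" "(A + x) powr \<gamma> = A powr \<gamma> + \<gamma> * \<xi> powr (\<gamma> - 1) * x"
    using powr_increment assms by metis
  have "0 \<le> \<eta>"
    using assms by (metis zero_le_mult_iff order_trans not_le)
  have "((1 + \<eta>) * A) powr (\<gamma> - 1) \<le> \<xi> powr (\<gamma> - 1)"
    using \<xi> assms by (intro powr_mono2') (auto simp: algebra_simps)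
  then have "(1 + \<eta>) powr (\<gamma> - 1) * A powr (\<gamma> - 1) \<le> \<xi> powr (\<gamma> - 1)"
    using \<open>0 \<le> \<eta>\<close> assms by (simp add: powr_mult)
  then show ?thesis
    unfolding \<xi>(3) using assms by (intro add_left_mono mult_right_mono mult_left_mono) auto
qed

context
  fixes \<gamma> d :: real
  assumes \<gamma>: "0 < \<gamma>" "\<gamma> < 1" and d: "d = real CARD('d::finite)"
begin

lemma d_pos: "0 < d"
  by (simp add: d)

text \<open>The heart of the asymptotics, with the power of \<open>A + (\<beta>/t)\<bar>z\<bar>\<close> replaced by its tangent. The
  geometric series contributes \<open>(2/\<mu>)\<^sup>d\<close> with \<open>\<mu> = \<gamma> A\<^bsup>\<gamma>-1\<^esup> \<beta>/t\<close>, which behaves like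
  \<open>(2 t (d ln t)\<^bsup>1/\<gamma>-1\<^esup> / ln ln t)\<^sup>d\<close>. The three factors are compensated by \<open>d ln t\<close>, by the
  term with \<open>ln ln t\<close> and by the term with \<open>ln ln ln t\<close> in the expansion of \<open>A\<^sup>\<gamma>\<close>.\<close>

lemma level_sum_tendsto:
  fixes \<beta> :: "real \<Rightarrow> real" and m :: "real \<Rightarrow> nat"
  assumes \<beta>: "((\<lambda>t. \<beta> t / ln (ln t)) \<longlongrightarrow> 1 / \<gamma>) at_top"
    and m: "\<forall>\<^sub>F t in at_top. t * ln t powr (1 / \<gamma> - 1) \<le> real (m t)"
  shows "((\<lambda>t. exp (- (level \<gamma> d y e t powr \<gamma>)) * (\<Sum>z\<in>cube (m t).
      exp (- (\<gamma> * level \<gamma> d y e t powr (\<gamma> - 1) * (\<beta> t / t) * real (l1 (z :: int ^ 'd))))))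
    \<longlongrightarrow> 2 ^ CARD('d) * d powr (d * (1 / \<gamma> - 1)) * exp (- (\<gamma> * y))) at_top"
proof -
  define p where "p = 1 / \<gamma>"
  have p: "1 < p" "(\<gamma> - 1) / \<gamma> = 1 - p"
    using \<gamma> by (auto simp: p_def diff_divide_distrib)
  let ?L = "level \<gamma> d y e"
  define r where "r t = ?L t powr (\<gamma> - 1) / ln t powr (1 - p)" for t
  define \<mu> where "\<mu> t = \<gamma> * ?L t powr (\<gamma> - 1) * (\<beta> t / t)" for t
  \<comment> \<open>Up to the explicit factor \<open>ln ln t / (t (ln t)\<^bsup>1/\<gamma>-1\<^esup>)\<close>, \<open>\<mu>\<close> has a positive limit.\<close>
  define \<nu> where "\<nu> t = \<gamma> * r t * (\<beta> t / ln (ln t))" for t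
  have r: "(r \<longlongrightarrow> d powr (1 - p)) at_top"
    using level_powr_ratio[OF \<gamma> d_pos, of y e "\<gamma> - 1"] unfolding r_def p(2) .
  have \<nu>: "(\<nu> \<longlongrightarrow> d powr (1 - p)) at_top"
  proof -
    have "(\<nu> \<longlongrightarrow> \<gamma> * d powr (1 - p) * (1 / \<gamma>)) at_top"
      unfolding \<nu>_def by (intro tendsto_intros r \<beta>)
    then show ?thesis
      using \<gamma> by simp
  qed
  have \<nu>_pos: "\<forall>\<^sub>F t in at_top. 0 < \<nu> t"
    using order_tendstoD(1)[OF \<nu>, of 0] d_pos by simp
  have \<mu>_eq: "\<forall>\<^sub>F t in at_top. \<mu> t = \<nu> t * (ln (ln t) / (t * ln t powr (p - 1)))"
    using ln_large[of 0] ln_ln_large[of 0]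
  proof eventually_elim
    case (elim t)
    have "ln t powr (1 - p) * ln t powr (p - 1) = 1"
      using elim by (simp flip: powr_add)
    then show ?case
      using elim by (simp add: \<mu>_def \<nu>_def r_def divide_simps mult_ac)
  qed
  have \<mu>_lim: "filterlim \<mu> (at_right 0) at_top"
  proof (rule tendsto_imp_filterlim_at_right)
    have "((\<lambda>t. ln (ln t) / (t * ln t powr (p - 1))) \<longlongrightarrow> 0) at_top"
      using p by real_asymp
    then have "((\<lambda>t. \<nu> t * (ln (ln t) / (t * ln t powr (p - 1)))) \<longlongrightarrow> d powr (1 - p) * 0) at_top"
      by (intro tendsto_intros \<nu>)
    then have "((\<lambda>t. \<nu> t * (ln (ln t) / (t * ln t powr (p - 1)))) \<longlongrightarrow> 0) at_top"
      by simp
    then show "(\<mu> \<longlongrightarrow> 0) at_top"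
      by (rule Lim_transform_eventually) (use \<mu>_eq in eventually_elim, simp)
    show "\<forall>\<^sub>F t in at_top. 0 < \<mu> t"
      using \<mu>_eq \<nu>_pos ln_large[of 0] ln_ln_large[of 0] eventually_gt_at_top[of 0]
      by eventually_elim simp
  qed
  have \<mu>m: "filterlim (\<lambda>t. \<mu> t * real (m t)) at_top at_top"
  proof (rule filterlim_at_top_mono)
    show "filterlim (\<lambda>t. \<nu> t * ln (ln t)) at_top at_top"
      by (rule filterlim_tendsto_pos_mult_at_top[OF \<nu>])
        (use d_pos in \<open>auto intro: filterlim_compose[OF ln_at_top ln_at_top]\<close>)
    show "\<forall>\<^sub>F t in at_top. \<nu> t * ln (ln t) \<le> \<mu> t * real (m t)"
      using \<mu>_eq \<nu>_pos m ln_large[of 0] ln_ln_large[of 0] eventually_gt_at_top[of 0]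
    proof eventually_elim
      case (elim t)
      have "\<nu> t * ln (ln t) = \<mu> t * (t * ln t powr (p - 1))"
        using elim by simp
      also have "\<dots> \<le> \<mu> t * real (m t)"
        using elim by (intro mult_left_mono) (auto simp: p_def)
      finally show ?case .
    qed
  qed
  define a where "a t = d * ln t + d * (1 / \<gamma> - 1) * ln (ln t) - d * ln (ln (ln t))" for t
  have "((\<lambda>t. exp (- (?L t powr \<gamma> - a t)) * (1 / \<nu> t) ^ CARD('d) *
      (\<mu> t ^ CARD('d) * (\<Sum>z\<in>cube (m t). exp (- (\<mu> t * real (l1 (z :: int ^ 'd)))))))
    \<longlongrightarrow> exp (- (\<gamma> * y)) * (1 / d powr (1 - p)) ^ CARD('d) * 2 ^ CARD('d)) at_top"
    unfolding a_def
    by (intro tendsto_intros level_powr_tendsto[OF \<gamma> d_pos] \<nu> tendsto_cube_sum \<mu>_lim \<mu>m) (use d_pos in auto)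
  moreover have "(1 / d powr (1 - p)) ^ CARD('d) = d powr (d * (1 / \<gamma> - 1))"
  proof -
    have "1 / d powr (1 - p) = d powr (p - 1)"
      using powr_minus_divide[of d "1 - p"] by simp
    then show ?thesis
      using d_pos by (simp add: p_def d powr_powr mult.commute flip: powr_realpow)
  qed
  ultimately have lim: "((\<lambda>t. exp (- (?L t powr \<gamma> - a t)) * (1 / \<nu> t) ^ CARD('d) *
      (\<mu> t ^ CARD('d) * (\<Sum>z\<in>cube (m t). exp (- (\<mu> t * real (l1 (z :: int ^ 'd)))))))
    \<longlongrightarrow> 2 ^ CARD('d) * d powr (d * (1 / \<gamma> - 1)) * exp (- (\<gamma> * y))) at_top"
    by (simp add: mult_ac)
  show ?thesis
  proof (rule Lim_transform_eventually[OF lim])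
    show "\<forall>\<^sub>F t in at_top. exp (- (?L t powr \<gamma> - a t)) * (1 / \<nu> t) ^ CARD('d) *
        (\<mu> t ^ CARD('d) * (\<Sum>z\<in>cube (m t). exp (- (\<mu> t * real (l1 (z :: int ^ 'd)))))) =
        exp (- (?L t powr \<gamma>)) * (\<Sum>z\<in>cube (m t).
          exp (- (\<gamma> * ?L t powr (\<gamma> - 1) * (\<beta> t / t) * real (l1 (z :: int ^ 'd)))))"
      using \<mu>_eq \<nu>_pos ln_large[of 0] ln_ln_large[of 0] eventually_gt_at_top[of 0]
    proof eventually_elim
      case (elim t)
      define q where "q = ln (ln t) / (t * ln t powr (p - 1))"
      have q: "0 < q" "\<mu> t = \<nu> t * q"
        using elim by (auto simp: q_def)
      have "ln q = - (ln t + (p - 1) * ln (ln t) - ln (ln (ln t)))"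
        using elim by (simp add: q_def ln_div ln_mult ln_powr)
      moreover have "a t = d * (ln t + (p - 1) * ln (ln t) - ln (ln (ln t)))"
        by (simp add: a_def p_def algebra_simps)
      ultimately have "a t = - (real CARD('d) * ln q)"
        by (simp only: d mult_minus_right minus_minus)
      then have "exp (a t) = 1 / exp (ln q) ^ CARD('d)"
        by (simp add: exp_minus inverse_eq_divide exp_of_nat_mult)
      then have "exp (a t) = 1 / q ^ CARD('d)"
        using q by simp
      then have "exp (- (?L t powr \<gamma> - a t)) = exp (- (?L t powr \<gamma>)) / q ^ CARD('d)"
        by (simp add: exp_diff exp_minus divide_simps)
      then have "exp (- (?L t powr \<gamma> - a t)) * (1 / \<nu> t) ^ CARD('d) * (\<mu> t ^ CARD('d)) = exp (- (?L t powr \<gamma>))"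
        using elim(2) q(1) by (simp add: q(2) power_mult_distrib power_divide)
      then show ?case
        unfolding \<mu>_def[symmetric] by (simp flip: mult.assoc)
    qed
  qed
qed

lemma level_sum_lower:
  assumes \<beta>: "0 \<le> \<beta> / t" and L: "0 < level \<gamma> d y e t"
  shows "exp (- (level \<gamma> d y e t powr \<gamma>)) * (\<Sum>z\<in>cube m.
      exp (- (\<gamma> * level \<gamma> d y e t powr (\<gamma> - 1) * (\<beta> / t) * real (l1 (z :: int ^ 'd)))))
    \<le> (\<Sum>z\<in>cube m. exp (- ((level \<gamma> d y e t + \<beta> / t * real (l1 (z :: int ^ 'd))) powr \<gamma>)))"
  unfolding sum_distrib_left
proof (rule sum_mono)
  fix z :: "int ^ 'd"
  have "(level \<gamma> d y e t + \<beta> / t * real (l1 z)) powr \<gamma> \<le>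
      level \<gamma> d y e t powr \<gamma> + \<gamma> * level \<gamma> d y e t powr (\<gamma> - 1) * (\<beta> / t * real (l1 z))"
    by (rule powr_tangent_above[OF \<gamma> L]) (use mult_nonneg_nonneg[OF \<beta>, of "real (l1 z)"] in auto)
  then show "exp (- (level \<gamma> d y e t powr \<gamma>)) * exp (- (\<gamma> * level \<gamma> d y e t powr (\<gamma> - 1) * (\<beta> / t) * real (l1 z)))
      \<le> exp (- ((level \<gamma> d y e t + \<beta> / t * real (l1 z)) powr \<gamma>))"
    by (simp add: mult.assoc flip: exp_add)
qed

text \<open>Sites with \<open>(\<beta>/t)\<bar>z\<bar> \<le> \<eta> A\<close> are compared with a chord of slope \<open>\<rho> = (1 + \<eta>)\<^bsup>\<gamma>-1\<^esup>\<close> times that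
  of the tangent. All others contribute at most \<open>exp (- ((1 + \<eta>) A)\<^sup>\<gamma>)\<close> each. The choice
  \<open>\<eta> = (ln t)\<^bsup>-1/2\<^esup>\<close> tends to zero, so that \<open>\<rho> \<rightarrow> 1\<close>, but slowly enough for the gain
  \<open>exp (- c (ln t)\<^bsup>1/2\<^esup>)\<close> to beat the polylogarithmic excess of sites in the cube.\<close>

lemma level_sum_upper:
  fixes \<beta> :: "real \<Rightarrow> real" and m :: "real \<Rightarrow> nat"
  assumes \<beta>: "((\<lambda>t. \<beta> t / ln (ln t)) \<longlongrightarrow> 1 / \<gamma>) at_top" and \<beta>0: "\<forall>\<^sub>F t in at_top. 0 \<le> \<beta> t"
    and m_ge: "\<forall>\<^sub>F t in at_top. t * ln t powr (1 / \<gamma> - 1) \<le> real (m t)"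
    and m_le: "\<forall>\<^sub>F t in at_top. 2 * real (m t) + 1 \<le> 3 * t * ln t powr (2 / \<gamma>)"
  obtains S where "(S \<longlongrightarrow> 2 ^ CARD('d) * d powr (d * (1 / \<gamma> - 1)) * exp (- (\<gamma> * y))) at_top"
    "\<forall>\<^sub>F t in at_top. (\<Sum>z\<in>cube (m t). exp (- ((level \<gamma> d y e t + \<beta> t / t * real (l1 (z :: int ^ 'd))) powr \<gamma>))) \<le> S t"
proof -
  define p where "p = 1 / \<gamma>"
  have p: "1 < p"
    using \<gamma> by (auto simp: p_def)
  let ?L = "level \<gamma> d y e" and ?n = "CARD('d)"
  define \<eta> where "\<eta> t = ln t powr (-1/2)" for t :: real
  define \<rho> where "\<rho> t = (1 + \<eta> t) powr (\<gamma> - 1)" for t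
  define S1 where "S1 t = exp (- (?L t powr \<gamma>)) * (\<Sum>z\<in>cube (m t).
      exp (- (\<gamma> * ?L t powr (\<gamma> - 1) * (\<rho> t * \<beta> t / t) * real (l1 (z :: int ^ 'd)))))" for t
  define S2 where "S2 t = (3 * t * ln t powr (2 / \<gamma>)) ^ ?n * exp (- ((1 + \<eta> t) powr \<gamma> * (d * ln t)))" for t
  have \<rho>: "(\<rho> \<longlongrightarrow> 1) at_top"
    unfolding \<rho>_def \<eta>_def by real_asymp
  have "((\<lambda>t. \<rho> t * (\<beta> t / ln (ln t))) \<longlongrightarrow> 1 * (1 / \<gamma>)) at_top"
    by (intro tendsto_intros \<rho> \<beta>)
  then have "((\<lambda>t. \<rho> t * \<beta> t / ln (ln t)) \<longlongrightarrow> 1 / \<gamma>) at_top"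
    by simp
  then have S1: "(S1 \<longlongrightarrow> 2 ^ ?n * d powr (d * (1 / \<gamma> - 1)) * exp (- (\<gamma> * y))) at_top"
    unfolding S1_def by (rule level_sum_tendsto[OF _ m_ge])
  have S2: "(S2 \<longlongrightarrow> 0) at_top"
  proof -
    have "((\<lambda>x. 3 ^ ?n * x powr (2 * p * d) * exp (d * x - (1 + x powr (-1/2)) powr \<gamma> * (d * x))) \<longlongrightarrow> 0) at_top"
      using p \<gamma> d_pos by real_asymp
    then have "((\<lambda>t. 3 ^ ?n * ln t powr (2 * p * d) * exp (d * ln t - (1 + ln t powr (-1/2)) powr \<gamma> * (d * ln t))) \<longlongrightarrow> 0) at_top"
      by (rule filterlim_compose) (rule ln_at_top)
    then show ?thesis
    proof (rule Lim_transform_eventually)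
      show "\<forall>\<^sub>F t in at_top. 3 ^ ?n * ln t powr (2 * p * d) * exp (d * ln t - (1 + ln t powr (-1/2)) powr \<gamma> * (d * ln t)) = S2 t"
        using ln_large[of 0] eventually_gt_at_top[of 0]
      proof eventually_elim
        case (elim t)
        have "exp (d * ln t) = t ^ ?n"
          using elim by (simp add: d exp_of_nat_mult)
        moreover have "ln t powr (2 * p * d) = (ln t powr (2 / \<gamma>)) ^ ?n"
          using elim by (simp add: p_def d powr_powr flip: powr_realpow)
        ultimately show ?case
          by (simp add: S2_def \<eta>_def exp_diff exp_minus power_mult_distrib field_simps)
      qed
    qed
  qed
  have le: "\<forall>\<^sub>F t in at_top. (\<Sum>z\<in>cube (m t). exp (- ((?L t + \<beta> t / t * real (l1 (z :: int ^ 'd))) powr \<gamma>))) \<le> S1 t + S2 t"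
    using \<beta>0 m_le level_pos[OF \<gamma> d_pos, of y e] level_powr_ge[OF \<gamma> d_pos, of y e]
      ln_large[of 0] eventually_gt_at_top[of 0]
  proof eventually_elim
    case (elim t)
    define D where "D = exp (- ((1 + \<eta> t) powr \<gamma> * (d * ln t)))"
    have \<eta>: "0 < \<eta> t"
      using elim by (simp add: \<eta>_def)
    have "exp (- ((?L t + \<beta> t / t * real (l1 z)) powr \<gamma>)) \<le>
        exp (- (?L t powr \<gamma>)) * exp (- (\<gamma> * ?L t powr (\<gamma> - 1) * (\<rho> t * \<beta> t / t) * real (l1 z))) + D" for z :: "int ^ 'd"
    proof (cases "\<beta> t / t * real (l1 z) \<le> \<eta> t * ?L t")
      case True
      have "?L t powr \<gamma> + \<gamma> * (\<rho> t * ?L t powr (\<gamma> - 1)) * (\<beta> t / t * real (l1 z)) \<le> (?L t + \<beta> t / t * real (l1 z)) powr \<gamma>"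
        unfolding \<rho>_def by (rule powr_chord_below[OF \<gamma> _ _ True]) (use elim in auto)
      then have "exp (- ((?L t + \<beta> t / t * real (l1 z)) powr \<gamma>)) \<le>
          exp (- (?L t powr \<gamma>) + - (\<gamma> * ?L t powr (\<gamma> - 1) * (\<rho> t * \<beta> t / t) * real (l1 z)))"
        by (simp add: mult_ac)
      also have "\<dots> \<le> exp (- (?L t powr \<gamma>)) * exp (- (\<gamma> * ?L t powr (\<gamma> - 1) * (\<rho> t * \<beta> t / t) * real (l1 z))) + D"
        unfolding exp_add by (simp add: D_def)
      finally show ?thesis .
    next
      case False
      have "(1 + \<eta> t) powr \<gamma> * (d * ln t) \<le> (1 + \<eta> t) powr \<gamma> * ?L t powr \<gamma>"
        using elim by (intro mult_left_mono) auto
      also have "\<dots> = ((1 + \<eta> t) * ?L t) powr \<gamma>"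
        using elim \<eta> by (simp add: powr_mult)
      also have "\<dots> \<le> (?L t + \<beta> t / t * real (l1 z)) powr \<gamma>"
        using elim \<eta> False \<gamma> by (intro powr_mono2) (auto simp: algebra_simps)
      finally have "exp (- ((?L t + \<beta> t / t * real (l1 z)) powr \<gamma>)) \<le> D"
        by (simp add: D_def)
      then show ?thesis
        by (smt (verit) exp_gt_zero mult_pos_pos)
    qed
    then have "(\<Sum>z\<in>cube (m t). exp (- ((?L t + \<beta> t / t * real (l1 (z :: int ^ 'd))) powr \<gamma>))) \<le>
        (\<Sum>z\<in>cube (m t). exp (- (?L t powr \<gamma>)) * exp (- (\<gamma> * ?L t powr (\<gamma> - 1) * (\<rho> t * \<beta> t / t) * real (l1 (z :: int ^ 'd)))) + D)"
      by (rule sum_mono)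
    also have "\<dots> = S1 t + real (card (cube (m t) :: (int ^ 'd) set)) * D"
      by (simp add: sum.distrib S1_def sum_distrib_left)
    also have "real (card (cube (m t) :: (int ^ 'd) set)) * D \<le> S2 t"
    proof -
      have "real (card (cube (m t) :: (int ^ 'd) set)) = (2 * real (m t) + 1) ^ ?n"
        by (simp add: card_cube add.commute)
      also have "\<dots> \<le> (3 * t * ln t powr (2 / \<gamma>)) ^ ?n"
        using elim by (intro power_mono) auto
      finally show ?thesis
        unfolding S2_def D_def by (intro mult_right_mono) auto
    qed
    finally show ?case
      by simp
  qed
  have "((\<lambda>t. S1 t + S2 t) \<longlongrightarrow> 2 ^ ?n * d powr (d * (1 / \<gamma> - 1)) * exp (- (\<gamma> * y)) + 0) at_top"
    by (intro tendsto_add S1 S2)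
  then show thesis
    using that[of "\<lambda>t. S1 t + S2 t"] le by simp
qed

end


section \<open>The random potential\<close>

text \<open>Outside the set where the family is summable, \<^const>\<open>infsum\<close> is zero; that set is measurable
  because it is described by bounded partial sums over cubes.\<close>

lemma total_mass_measurable:
  fixes u :: "real \<Rightarrow> int ^ 'd \<Rightarrow> 'a \<Rightarrow> real"
  assumes [measurable]: "\<And>z. u t z \<in> borel_measurable M"
  shows "(\<lambda>\<omega>. total_mass (\<lambda>s z. u s z \<omega>) t) \<in> borel_measurable M"
proof -
  define Q where "Q N = (cube N :: (int ^ 'd) set)" for N
  define P where "P \<omega> \<longleftrightarrow> (\<exists>B::nat. \<forall>N. (\<Sum>z\<in>Q N. \<bar>u t z \<omega>\<bar>) \<le> real B)" for \<omega>
  have [measurable]: "Measurable.pred M P"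
    unfolding P_def by measurable
  have "total_mass (\<lambda>s z. u s z \<omega>) t = (if P \<omega> then lim (\<lambda>N. \<Sum>z\<in>Q N. u t z \<omega>) else 0)" for \<omega>
  proof (cases "(\<lambda>z. u t z \<omega>) summable_on UNIV")
    case True
    then have abs: "(\<lambda>z. \<bar>u t z \<omega>\<bar>) summable_on UNIV"
      using summable_on_iff_abs_summable_on_real by fastforce
    obtain B :: nat where "(\<Sum>\<^sub>\<infinity>z. \<bar>u t z \<omega>\<bar>) \<le> real B"
      using real_arch_simple by blast
    moreover have "(\<Sum>z\<in>Q N. \<bar>u t z \<omega>\<bar>) \<le> (\<Sum>\<^sub>\<infinity>z. \<bar>u t z \<omega>\<bar>)" for N
      using abs by (intro finite_sum_le_infsum) (auto simp: Q_def)
    ultimately have P: "P \<omega>"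
      unfolding P_def by (meson order_trans)
    have Q: "filterlim Q (finite_subsets_at_top UNIV) sequentially"
    proof (subst filterlim_finite_subsets_at_top, intro allI impI)
      fix F :: "(int ^ 'd) set" assume F: "finite F \<and> F \<subseteq> UNIV"
      show "\<forall>\<^sub>F N in sequentially. finite (Q N) \<and> F \<subseteq> Q N \<and> Q N \<subseteq> UNIV"
        using eventually_ge_at_top[of "Max (insert 0 (l1 ` F))"]
      proof eventually_elim
        case (elim N)
        then have "l1 z \<le> N" if "z \<in> F" for z
          using F that by auto
        then show ?case
          by (auto simp: Q_def intro: l1_ball_subset_cube)
      qed
    qed
    have "((\<lambda>z. u t z \<omega>) has_sum (\<Sum>\<^sub>\<infinity>z. u t z \<omega>)) UNIV"
      using True by (rule has_sum_infsum)
    then have "(\<lambda>N. \<Sum>z\<in>Q N. u t z \<omega>) \<longlonglongrightarrow> (\<Sum>\<^sub>\<infinity>z. u t z \<omega>)"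
      unfolding has_sum_def by (rule filterlim_compose) (rule Q)
    then show ?thesis
      using P by (simp add: total_mass_def limI)
  next
    case False
    have "\<not> P \<omega>"
    proof
      assume "P \<omega>"
      then obtain B :: nat where B: "\<And>N. (\<Sum>z\<in>Q N. \<bar>u t z \<omega>\<bar>) \<le> real B"
        unfolding P_def by blast
      have "(\<lambda>z. \<bar>u t z \<omega>\<bar>) summable_on UNIV"
      proof (rule nonneg_bounded_partial_sums_imp_summable_on[where C = "real B"])
        have "(\<Sum>z\<in>F. \<bar>u t z \<omega>\<bar>) \<le> real B" if F: "finite F" for F
        proof -
          have "F \<subseteq> Q (Max (insert 0 (l1 ` F)))"
            unfolding Q_def using F by (intro subsetI l1_ball_subset_cube) auto
          then have "(\<Sum>z\<in>F. \<bar>u t z \<omega>\<bar>) \<le> (\<Sum>z\<in>Q (Max (insert 0 (l1 ` F))). \<bar>u t z \<omega>\<bar>)"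
            by (intro sum_mono2) (auto simp: Q_def)
          then show ?thesis
            using B order_trans by blast
        qed
        then show "\<forall>\<^sub>F F in finite_subsets_at_top UNIV. (\<Sum>z\<in>F. \<bar>u t z \<omega>\<bar>) \<le> real B"
          by (intro eventually_finite_subsets_at_top_weakI)
      qed auto
      then have "(\<lambda>z. norm (u t z \<omega>)) summable_on UNIV"
        by simp
      then show False
        using False summable_on_iff_abs_summable_on_real by blast
    qed
    then show ?thesis
      using False by (simp add: total_mass_def infsum_not_exists)
  qed
  moreover have "(\<lambda>\<omega>. if P \<omega> then lim (\<lambda>N. \<Sum>z\<in>Q N. u t z \<omega>) else 0) \<in> borel_measurable M"
    by measurable
  ultimately show ?thesis
    by simp
qed

locale weibull_potential = prob_space M for M :: "'a measure" +
  fixes \<xi> :: "int ^ 'd \<Rightarrow> 'a \<Rightarrow> real" and \<gamma> :: real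
  assumes \<gamma>: "0 < \<gamma>" "\<gamma> < 1"
    and indep: "indep_vars (\<lambda>_. borel) \<xi> UNIV"
    and cdf: "\<And>z x. measure M {\<omega> \<in> space M. \<xi> z \<omega> \<le> x} = weibull_cdf \<gamma> x"
begin

lemma measurable_potential [measurable]: "\<xi> z \<in> borel_measurable M"
  using indep by (auto simp: indep_vars_def)

lemma prob_le: "0 \<le> x \<Longrightarrow> prob {\<omega> \<in> space M. \<xi> z \<omega> \<le> x} = 1 - exp (- (x powr \<gamma>))"
  by (simp add: cdf weibull_cdf_def)

lemma prob_gt:
  assumes "0 \<le> x"
  shows "prob {\<omega> \<in> space M. x < \<xi> z \<omega>} = exp (- (x powr \<gamma>))"
proof -
  have "{\<omega> \<in> space M. x < \<xi> z \<omega>} = space M - {\<omega> \<in> space M. \<xi> z \<omega> \<le> x}"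
    by auto
  then show ?thesis
    using assms by (simp add: prob_compl prob_le)
qed

lemma AE_potential_nonneg: "AE \<omega> in M. \<forall>z. 0 \<le> \<xi> z \<omega>"
proof -
  have "AE \<omega> in M. 0 \<le> \<xi> z \<omega>" for z
  proof -
    have "prob {\<omega> \<in> space M. \<xi> z \<omega> \<le> 0} = 0"
      using prob_le[of 0 z] by simp
    then have "AE \<omega> in M. \<not> \<xi> z \<omega> \<le> 0"
      by (subst AE_iff_measurable[OF _ refl]) (auto simp: emeasure_eq_measure)
    then show ?thesis
      by (rule AE_mp) auto
  qed
  then show ?thesis
    by (subst AE_all_countable) auto
qed

lemma prob_all_le:
  assumes F: "finite F" and q: "\<And>z. z \<in> F \<Longrightarrow> 0 \<le> q z"
  shows "prob {\<omega> \<in> space M. \<forall>z\<in>F. \<xi> z \<omega> \<le> q z} = (\<Prod>z\<in>F. 1 - exp (- (q z powr \<gamma>)))"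
proof (cases "F = {}")
  case True
  then show ?thesis
    by (simp add: prob_space)
next
  case False
  have "prob (\<Inter>z\<in>F. \<xi> z -` {..q z} \<inter> space M) = (\<Prod>z\<in>F. prob (\<xi> z -` {..q z} \<inter> space M))"
    by (rule indep_varsD[OF indep]) (use F False in auto)
  moreover have "(\<Inter>z\<in>F. \<xi> z -` {..q z} \<inter> space M) = {\<omega> \<in> space M. \<forall>z\<in>F. \<xi> z \<omega> \<le> q z}"
    using False by auto
  moreover have "prob (\<xi> z -` {..q z} \<inter> space M) = 1 - exp (- (q z powr \<gamma>))" if "z \<in> F" for z
  proof -
    have "\<xi> z -` {..q z} \<inter> space M = {\<omega> \<in> space M. \<xi> z \<omega> \<le> q z}"
      by auto
    then show ?thesis
      using prob_le q that by simp
  qed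
  ultimately show ?thesis
    by simp
qed

lemma prob_all_le_upper:
  assumes F: "finite F" and q: "\<And>z. z \<in> F \<Longrightarrow> 0 \<le> q z"
  shows "prob {\<omega> \<in> space M. \<forall>z\<in>F. \<xi> z \<omega> \<le> q z} \<le> exp (- (\<Sum>z\<in>F. exp (- (q z powr \<gamma>))))"
proof -
  have "(\<Prod>z\<in>F. 1 - exp (- (q z powr \<gamma>))) \<le> (\<Prod>z\<in>F. exp (- exp (- (q z powr \<gamma>))))"
  proof (rule prod_mono)
    fix z
    show "0 \<le> 1 - exp (- (q z powr \<gamma>)) \<and> 1 - exp (- (q z powr \<gamma>)) \<le> exp (- exp (- (q z powr \<gamma>)))"
      using exp_ge_add_one_self[of "- exp (- (q z powr \<gamma>))"] by simp
  qed
  then show ?thesis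
    using prob_all_le[OF assms] by (simp add: exp_sum[OF F, symmetric] sum_negf)
qed

text \<open>The counterpart \<open>1 - p \<ge> exp (- p / (1 - p))\<close> of the usual \<open>1 - p \<le> exp (- p)\<close>; the correction
  is uniform because all thresholds lie above \<open>q\<^sub>0\<close>.\<close>

lemma prob_all_le_lower:
  assumes F: "finite F" and q: "\<And>z. z \<in> F \<Longrightarrow> q\<^sub>0 \<le> q z" and q0: "0 < q\<^sub>0"
  shows "exp (- ((\<Sum>z\<in>F. exp (- (q z powr \<gamma>))) / (1 - exp (- (q\<^sub>0 powr \<gamma>)))))
    \<le> prob {\<omega> \<in> space M. \<forall>z\<in>F. \<xi> z \<omega> \<le> q z}"
proof -
  define c where "c = 1 - exp (- (q\<^sub>0 powr \<gamma>))"
  have c: "0 < c"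
    using q0 by (simp add: c_def)
  have "exp (- ((\<Sum>z\<in>F. exp (- (q z powr \<gamma>))) / c)) = (\<Prod>z\<in>F. exp (- (exp (- (q z powr \<gamma>)) / c)))"
    by (simp add: exp_sum[OF F, symmetric] sum_negf sum_divide_distrib)
  also have "\<dots> \<le> (\<Prod>z\<in>F. 1 - exp (- (q z powr \<gamma>)))"
  proof (rule prod_mono, rule conjI)
    fix z assume z: "z \<in> F"
    define p where "p = exp (- (q z powr \<gamma>))"
    have "q\<^sub>0 powr \<gamma> \<le> q z powr \<gamma>"
      using q[OF z] q0 \<gamma> by (intro powr_mono2) auto
    then have p: "0 < p" "c \<le> 1 - p"
      by (auto simp: p_def c_def)
    have "1 + p / c \<le> exp (p / c)"
      by (rule exp_ge_add_one_self)
    moreover have "p / (1 - p) \<le> p / c"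
      using p c by (intro divide_left_mono) auto
    ultimately have "1 + p / (1 - p) \<le> exp (p / c)"
      by linarith
    moreover have "1 + p / (1 - p) = 1 / (1 - p)"
      using p c by (simp add: divide_simps)
    ultimately have "1 / (1 - p) \<le> exp (p / c)"
      by simp
    then show "exp (- (exp (- (q z powr \<gamma>)) / c)) \<le> 1 - exp (- (q z powr \<gamma>))"
      unfolding p_def[symmetric] using p c by (simp add: exp_minus divide_simps mult.commute)
  qed auto
  also have "\<dots> = prob {\<omega> \<in> space M. \<forall>z\<in>F. \<xi> z \<omega> \<le> q z}"
    by (rule prob_all_le[symmetric]) (use F q q0 in force)+
  finally show ?thesis
    by (simp add: c_def)
qed

lemma prob_exceed_finite:
  assumes F: "finite F" and q: "\<And>z. z \<in> F \<Longrightarrow> 0 \<le> q z"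
  shows "prob {\<omega> \<in> space M. \<exists>z\<in>F. q z < \<xi> z \<omega>} \<le> (\<Sum>z\<in>F. exp (- (q z powr \<gamma>)))"
proof -
  have "prob (\<Union>z\<in>F. {\<omega> \<in> space M. q z < \<xi> z \<omega>}) \<le> (\<Sum>z\<in>F. prob {\<omega> \<in> space M. q z < \<xi> z \<omega>})"
    by (rule finite_measure_subadditive_finite) (use F in auto)
  also have "\<dots> = (\<Sum>z\<in>F. exp (- (q z powr \<gamma>)))"
    using q by (intro sum.cong) (auto simp: prob_gt)
  also have "(\<Union>z\<in>F. {\<omega> \<in> space M. q z < \<xi> z \<omega>}) = {\<omega> \<in> space M. \<exists>z\<in>F. q z < \<xi> z \<omega>}"
    by auto
  finally show ?thesis .
qed

text \<open>A union bound over infinitely many sites. Half of \<open>(\<bar>z\<bar>/t)\<^sup>\<gamma>\<close> makes the sum converge;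
  whatever the thresholds leave beyond that is the gain \<open>r\<close>.\<close>

lemma prob_exceed:
  "\<exists>C>0. \<forall>t\<ge>1. \<forall>r Z q. (\<forall>z\<in>Z. 0 \<le> q z \<and> r + (real (l1 z) / t) powr \<gamma> / 2 \<le> q z powr \<gamma>) \<longrightarrow>
      prob {\<omega> \<in> space M. \<exists>z\<in>Z. q z < \<xi> z \<omega>} \<le> C * t ^ (2 * CARD('d)) * exp (- r)"
proof -
  obtain C where C: "0 < C" "\<And>t F. 1 \<le> t \<Longrightarrow> finite F \<Longrightarrow>
    (\<Sum>z\<in>F. exp (- ((real (l1 (z :: int ^ 'd)) / t) powr \<gamma> / 2))) \<le> C * t ^ (2 * CARD('d))"
    using stretched_exp_sum_bound[OF \<gamma>(1), where 'd = 'd] by metis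
  have "prob {\<omega> \<in> space M. \<exists>z\<in>Z. q z < \<xi> z \<omega>} \<le> C * t ^ (2 * CARD('d)) * exp (- r)"
    if t: "1 \<le> t" and q0: "\<And>z. z \<in> Z \<Longrightarrow> 0 \<le> q z"
      and q: "\<And>z. z \<in> Z \<Longrightarrow> r + (real (l1 z) / t) powr \<gamma> / 2 \<le> q z powr \<gamma>" for t r Z q
  proof -
    define E where "E N = {\<omega> \<in> space M. \<exists>z\<in>Z \<inter> cube N. q z < \<xi> z \<omega>}" for N
    have E: "prob (E N) \<le> C * t ^ (2 * CARD('d)) * exp (- r)" for N
    proof -
      have "prob (E N) \<le> (\<Sum>z\<in>Z \<inter> cube N. exp (- (q z powr \<gamma>)))"
        unfolding E_def by (rule prob_exceed_finite) (auto intro: q0)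
      also have "\<dots> \<le> (\<Sum>z\<in>Z \<inter> cube N. exp (- ((real (l1 z) / t) powr \<gamma> / 2)) * exp (- r))"
        using q by (intro sum_mono) (force simp flip: exp_add)
      also have "\<dots> \<le> C * t ^ (2 * CARD('d)) * exp (- r)"
        unfolding sum_distrib_right[symmetric] by (intro mult_right_mono C t) auto
      finally show ?thesis .
    qed
    have "(\<lambda>N. prob (E N)) \<longlonglongrightarrow> prob (\<Union>N. E N)"
    proof (rule finite_Lim_measure_incseq)
      have "cube N \<subseteq> (cube (Suc N) :: (int ^ 'd) set)" for N
      proof -
        have "{- int N..int N} \<subseteq> {- int (Suc N)..int (Suc N)}"
          by auto
        then show ?thesis
          unfolding cube_def by blast
      qed
      then show "incseq E"
        unfolding E_def by (intro incseq_SucI) blast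
      show "range E \<subseteq> sets M"
        unfolding E_def by auto
    qed
    then have "prob (\<Union>N. E N) \<le> C * t ^ (2 * CARD('d)) * exp (- r)"
      by (rule LIMSEQ_le_const2) (use E in auto)
    also have "(\<Union>N. E N) = {\<omega> \<in> space M. \<exists>z\<in>Z. q z < \<xi> z \<omega>}"
      unfolding E_def using l1_ball_subset_cube by blast
    finally show ?thesis .
  qed
  with C(1) show ?thesis
    by (intro exI[of _ C]) auto
qed

text \<open>The growth condition that makes the total mass at time \<open>t\<close> finite.\<close>

lemma AE_linear_growth:
  assumes t: "1 \<le> t"
  shows "AE \<omega> in M. \<exists>c\<ge>0. \<forall>z. \<xi> z \<omega> \<le> c + real (l1 z) / t"
proof -
  obtain C where C: "0 < C" and tail: "\<forall>t\<ge>1. \<forall>r Z q. (\<forall>z\<in>Z. 0 \<le> q z \<and> r + (real (l1 z) / t) powr \<gamma> / 2 \<le> q z powr \<gamma>) \<longrightarrow>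
      prob {\<omega> \<in> space M. \<exists>z\<in>Z. q z < \<xi> z \<omega>} \<le> C * t ^ (2 * CARD('d)) * exp (- r)"
    using prob_exceed by (elim exE conjE) (rule that)
  define E where "E = {\<omega> \<in> space M. \<forall>N::nat. \<exists>z. real N + real (l1 z) / t < \<xi> z \<omega>}"
  have E_meas: "E \<in> sets M"
    unfolding E_def by measurable
  have bound: "prob E \<le> C * t ^ (2 * CARD('d)) * exp (- (real N powr \<gamma> / 2))" for N
  proof -
    have "prob E \<le> prob {\<omega> \<in> space M. \<exists>z\<in>UNIV. real N + real (l1 z) / t < \<xi> z \<omega>}"
      by (rule finite_measure_mono) (auto simp: E_def)
    also have "\<dots> \<le> C * t ^ (2 * CARD('d)) * exp (- (real N powr \<gamma> / 2))"
    proof (rule tail[THEN spec, THEN mp, OF t, THEN spec, THEN spec, THEN spec, THEN mp], intro ballI conjI)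
      fix z :: "int ^ 'd"
      have "real N powr \<gamma> \<le> (real N + real (l1 z) / t) powr \<gamma>"
        "(real (l1 z) / t) powr \<gamma> \<le> (real N + real (l1 z) / t) powr \<gamma>"
        using \<gamma> t by (auto intro!: powr_mono2)
      then show "real N powr \<gamma> / 2 + (real (l1 z) / t) powr \<gamma> / 2 \<le> (real N + real (l1 z) / t) powr \<gamma>"
        by linarith
    qed (use t in auto)
    finally show ?thesis .
  qed
  have "((\<lambda>N::nat. exp (- (real N powr \<gamma> / 2))) \<longlongrightarrow> 0) sequentially"
    using \<gamma> by real_asymp
  then have "(\<lambda>N. C * t ^ (2 * CARD('d)) * exp (- (real N powr \<gamma> / 2))) \<longlonglongrightarrow> C * t ^ (2 * CARD('d)) * 0"
    by (intro tendsto_intros)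
  then have "prob E \<le> C * t ^ (2 * CARD('d)) * 0"
    by (rule LIMSEQ_le_const) (use bound in auto)
  then have "prob E = 0"
    using measure_nonneg[of M E] by simp
  then have "AE \<omega> in M. \<not> (\<forall>N::nat. \<exists>z. real N + real (l1 z) / t < \<xi> z \<omega>)"
    by (subst AE_iff_measurable[OF E_meas]) (auto simp: E_def emeasure_eq_measure)
  then show ?thesis
  proof (rule AE_mp, intro AE_I2 impI)
    fix \<omega> assume "\<not> (\<forall>N::nat. \<exists>z. real N + real (l1 z) / t < \<xi> z \<omega>)"
    then obtain N :: nat where "\<forall>z. \<xi> z \<omega> \<le> real N + real (l1 z) / t"
      by (auto simp: not_less)
    then show "\<exists>c\<ge>0. \<forall>z. \<xi> z \<omega> \<le> c + real (l1 z) / t"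
      by (intro exI[of _ "real N"]) auto
  qed
qed

text \<open>Markov's inequality for the number of peaks.\<close>

lemma prob_many_peaks:
  assumes F: "finite F" and h: "0 \<le> h" and k: "0 < k"
  shows "prob {\<omega> \<in> space M. k < real (card {z \<in> F. h < \<xi> z \<omega>})} \<le> real (card F) * exp (- (h powr \<gamma>)) / k"
proof -
  define X where "X \<omega> = (\<Sum>z\<in>F. indicator {\<omega> \<in> space M. h < \<xi> z \<omega>} \<omega> :: real)" for \<omega>
  have X: "X \<omega> = real (card {z \<in> F. h < \<xi> z \<omega>})" if "\<omega> \<in> space M" for \<omega>
    using F that by (simp add: X_def indicator_def sum.If_cases Int_def)
  have int: "integrable M (indicator {\<omega> \<in> space M. h < \<xi> z \<omega>} :: 'a \<Rightarrow> real)" for z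
    by (rule integrable_real_indicator) (auto simp: emeasure_eq_measure)
  have "prob {\<omega> \<in> space M. k \<le> X \<omega>} \<le> expectation X / k"
    by (rule integral_Markov_inequality_measure[where A = "{}"])
      (use int k in \<open>auto simp: X_def intro!: sum_nonneg\<close>)
  also have "expectation X = (\<Sum>z\<in>F. prob {\<omega> \<in> space M. h < \<xi> z \<omega>})"
    unfolding X_def using int by (subst Bochner_Integration.integral_sum) auto
  also have "\<dots> = real (card F) * exp (- (h powr \<gamma>))"
    using h by (simp add: prob_gt)
  finally have "prob {\<omega> \<in> space M. k \<le> X \<omega>} \<le> real (card F) * exp (- (h powr \<gamma>)) / k" .
  moreover have "prob {\<omega> \<in> space M. k < real (card {z \<in> F. h < \<xi> z \<omega>})} \<le> prob {\<omega> \<in> space M. k \<le> X \<omega>}"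
    by (rule finite_measure_mono) (use X in \<open>auto simp: X_def\<close>)
  ultimately show ?thesis
    by linarith
qed

end


section \<open>The limit law\<close>

context weibull_potential
begin

context
  fixes u :: "real \<Rightarrow> int ^ 'd \<Rightarrow> 'a \<Rightarrow> real" and d :: real
  assumes d: "d = real CARD('d)"
    and u_meas: "\<And>t z. 0 < t \<Longrightarrow> u t z \<in> borel_measurable M"
    and pam: "AE \<omega> in M. pam_solution (\<lambda>z. \<xi> z \<omega>) (\<lambda>t z. u t z \<omega>)"
begin

abbreviation mass :: "real \<Rightarrow> 'a \<Rightarrow> real" where
  "mass t \<omega> \<equiv> total_mass (\<lambda>s z. u s z \<omega>) t"

lemma mass_measurable: "0 < t \<Longrightarrow> mass t \<in> borel_measurable M"
  using total_mass_measurable u_meas by blast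

lemma AE_summable:
  assumes t: "1 \<le> t"
  shows "AE \<omega> in M. (\<lambda>z. u t z \<omega>) summable_on UNIV"
  using pam AE_potential_nonneg AE_linear_growth[OF t]
proof eventually_elim
  case (elim \<omega>)
  then obtain c where c: "0 \<le> c" "\<And>z. \<xi> z \<omega> \<le> c + real (l1 z) / t"
    by blast
  show ?case
  proof (rule total_mass_upper_bound_sparse_peaks(1)[OF elim(1)])
    show "c + 2 * real CARD('d) * exp 1 \<le> c + 2 * real CARD('d) * exp 1" ..
    show "\<xi> z \<omega> \<le> c + max 0 (real (l1 z) - 2 * real (card ({} :: (int ^ 'd) set))) * (ln (exp 1) / t)" for z
      using c(2)[of z] by simp
  qed (use elim t c in auto)
qed

text \<open>The total mass is small on the intersection of three events: every site in a cube of size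
  about \<open>t (ln t)\<^bsup>2/\<gamma>\<^esup>\<close> lies below the threshold \<open>A' + (\<beta>/t)\<bar>z\<bar>\<close>; the cube contains at most
  \<open>t\<^bsup>1/2\<^esup>\<close> peaks; and outside it the potential is below \<open>\<bar>z\<bar>/t\<close>. The first event has
  asymptotically the Gumbel probability, the complements of the others are negligible.\<close>

lemma prob_small_mass_lower:
  obtains G where "(G \<longlongrightarrow> exp (- (2 ^ CARD('d) * d powr (d * (1 / \<gamma> - 1)) * exp (- (\<gamma> * y))))) at_top"
    "\<forall>\<^sub>F t in at_top. G t \<le> prob {\<omega> \<in> space M. ln (mass t \<omega>) / t \<le> level \<gamma> d y 0 t}"
proof -
  let ?n = "CARD('d)"
  define p where "p = 1 / \<gamma>"
  have p: "1 < p"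
    using \<gamma> by (simp add: p_def)
  have d1: "1 \<le> d"
    by (simp add: d Suc_le_eq)
  then have d0: "0 < d"
    by simp
  define \<theta> where "\<theta> = 2 ^ ?n * d powr (d * (1 / \<gamma> - 1))"
  define \<kappa> where "\<kappa> = (d powr p - (d - 1/4) powr p) / (4 * d)"
  have \<kappa>: "0 < \<kappa>"
  proof -
    have "(d - 1/4) powr p < d powr p"
      using d1 p by (intro powr_less_mono2) auto
    then show ?thesis
      using d0 by (simp add: \<kappa>_def)
  qed
  define K where "K t = \<kappa> * ln t powr p" for t
  define \<beta> where "\<beta> t = ln (K t)" for t
  \<comment> \<open>The expected number of sites above \<open>h\<close> in the cube is \<open>t\<^bsup>1/4\<^esup>\<close> up to powers of \<open>ln t\<close>, below \<open>t\<^bsup>1/2\<^esup>\<close>,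
      while \<open>\<kappa>\<close> leaves room for \<open>h + 2 d K\<close> below the leading term \<open>(d ln t)\<^bsup>1/\<gamma>\<^esup>\<close> of the level.\<close>
  define h where "h t = ((d - 1/4) * ln t) powr p" for t
  define m where "m t = nat \<lceil>t * ln t powr (2 / \<gamma>)\<rceil>" for t
  \<comment> \<open>One unit of slack absorbs the factor two in the bound of the total mass, another one the peaks.\<close>
  define A where "A = level \<gamma> d y (-1)"
  define A' where "A' = level \<gamma> d y (-2)"
  have AA': "A t = level \<gamma> d y 0 t - 1" "A' t = A t - 1" for t
    by (simp_all add: A_def A'_def level_def)
  have \<beta>_lim: "((\<lambda>t. \<beta> t / ln (ln t)) \<longlongrightarrow> 1 / \<gamma>) at_top"
    unfolding \<beta>_def K_def p_def[symmetric] using \<kappa> p by real_asymp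
  have \<beta>_ge: "\<forall>\<^sub>F t in at_top. 2 \<le> \<beta> t"
  proof -
    have "filterlim \<beta> at_top at_top"
      unfolding \<beta>_def K_def using \<kappa> p by real_asymp
    then show ?thesis
      by (simp add: filterlim_at_top)
  qed
  have \<beta>_sqrt: "\<forall>\<^sub>F t in at_top. 2 * \<beta> t / sqrt t < 1"
  proof -
    have "((\<lambda>t. 2 * \<beta> t / sqrt t) \<longlongrightarrow> 0) at_top"
      unfolding \<beta>_def K_def using \<kappa> p by real_asymp
    then show ?thesis
      by (rule order_tendstoD) simp
  qed
  have m_bound: "\<forall>\<^sub>F t in at_top. t * ln t powr (2 / \<gamma>) \<le> real (m t) \<and> real (m t) \<le> t * ln t powr (2 / \<gamma>) + 1"
    using eventually_gt_at_top[of 0]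
  proof eventually_elim
    case (elim t)
    then have "0 \<le> t * ln t powr (2 / \<gamma>)"
      by simp
    then show ?case
      unfolding m_def by linarith
  qed
  have m_ge: "\<forall>\<^sub>F t in at_top. t * ln t powr (1 / \<gamma> - 1) \<le> real (m t)"
    using m_bound ln_large[of 1] eventually_gt_at_top[of 0]
  proof eventually_elim
    case (elim t)
    have "ln t powr (1 / \<gamma> - 1) \<le> ln t powr (2 / \<gamma>)"
      using elim \<gamma> by (intro powr_mono) (auto simp: field_simps)
    then have "t * ln t powr (1 / \<gamma> - 1) \<le> t * ln t powr (2 / \<gamma>)"
      using elim by (intro mult_left_mono) auto
    with elim show ?case
      by linarith
  qed
  have m_le: "\<forall>\<^sub>F t in at_top. 2 * real (m t) + 1 \<le> 3 * t * ln t powr (2 / \<gamma>)"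
    using m_bound ln_large[of 1] eventually_ge_at_top[of 3]
  proof eventually_elim
    case (elim t)
    have "3 * 1 \<le> t * ln t powr (2 / \<gamma>)"
      using elim \<gamma> by (intro mult_mono ge_one_powr_ge_zero) auto
    with elim show ?case
      by linarith
  qed
  have far: "\<forall>\<^sub>F t in at_top. 4 * sqrt t \<le> t * ln t powr (2 / \<gamma>)"
    using ln_large[of 1] eventually_ge_at_top[of 16]
  proof eventually_elim
    case (elim t)
    have "4 * sqrt t \<le> sqrt t * sqrt t"
      using elim by (intro mult_right_mono real_le_rsqrt) auto
    also have "\<dots> * 1 \<le> t * ln t powr (2 / \<gamma>)"
      using elim \<gamma> by (intro mult_mono ge_one_powr_ge_zero) auto
    finally show ?case
      by simp
  qed
  have hK: "\<forall>\<^sub>F t in at_top. h t + 2 * d * K t \<le> A t"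
  proof -
    have lim: "((\<lambda>t. A t / ln t powr p - ((d - 1/4) powr p + 2 * d * \<kappa>)) \<longlongrightarrow> d powr p - ((d - 1/4) powr p + 2 * d * \<kappa>)) at_top"
      unfolding A_def p_def by (intro tendsto_diff tendsto_const level_ratio[OF \<gamma> d0])
    have gap: "d powr p - ((d - 1/4) powr p + 2 * d * \<kappa>) = 2 * d * \<kappa>"
      using d0 by (simp add: \<kappa>_def field_simps)
    have "\<forall>\<^sub>F t in at_top. 0 < A t / ln t powr p - ((d - 1/4) powr p + 2 * d * \<kappa>)"
      by (rule order_tendstoD(1)[OF lim]) (unfold gap, use \<kappa> d0 in simp)
    then show ?thesis
      using ln_large[of 0]
    proof eventually_elim
      case (elim t)
      then have "((d - 1/4) powr p + 2 * d * \<kappa>) * ln t powr p \<le> A t"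
        by (simp add: pos_less_divide_eq less_imp_le)
      moreover have "h t = (d - 1/4) powr p * ln t powr p"
        unfolding h_def by (rule powr_mult)
      ultimately show ?case
        by (simp add: K_def distrib_right mult.assoc)
    qed
  qed
  obtain S where S: "(S \<longlongrightarrow> \<theta> * exp (- (\<gamma> * y))) at_top"
    and S_ge: "\<forall>\<^sub>F t in at_top. (\<Sum>z\<in>cube (m t). exp (- ((A' t + \<beta> t / t * real (l1 (z :: int ^ 'd))) powr \<gamma>))) \<le> S t"
    unfolding \<theta>_def A'_def
    by (rule level_sum_upper[OF \<gamma> d \<beta>_lim _ m_ge m_le]) (use \<beta>_ge in \<open>auto elim: eventually_mono\<close>)
  obtain C where C: "0 < C" and tail: "\<forall>t\<ge>1. \<forall>r Z q. (\<forall>z\<in>Z. 0 \<le> q z \<and> r + (real (l1 z) / t) powr \<gamma> / 2 \<le> q z powr \<gamma>) \<longrightarrow>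
      prob {\<omega> \<in> space M. \<exists>z\<in>Z. q z < \<xi> z \<omega>} \<le> C * t ^ (2 * ?n) * exp (- r)"
    using prob_exceed by (elim exE conjE) (rule that)
  define P2 where "P2 t = (3 * t * ln t powr (2 / \<gamma>)) ^ ?n * exp (- (h t powr \<gamma>)) / sqrt t" for t
  define P3 where "P3 t = C * t ^ (2 * ?n) * exp (- ((ln t)\<^sup>2 / 2))" for t
  define G where "G t = exp (- (S t / (1 - exp (- (A' t powr \<gamma>))))) - P2 t - P3 t" for t
  have P2: "(P2 \<longlongrightarrow> 0) at_top"
  proof -
    have "((\<lambda>x. 3 ^ ?n * x powr (2 * p * d) * exp (- x / 4)) \<longlongrightarrow> 0) at_top"
      using p d0 by real_asymp
    then have "((\<lambda>t. 3 ^ ?n * ln t powr (2 * p * d) * exp (- ln t / 4)) \<longlongrightarrow> 0) at_top"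
      by (rule filterlim_compose) (rule ln_at_top)
    then show ?thesis
    proof (rule Lim_transform_eventually)
      show "\<forall>\<^sub>F t in at_top. 3 ^ ?n * ln t powr (2 * p * d) * exp (- ln t / 4) = P2 t"
        using ln_large[of 0] eventually_gt_at_top[of 0]
      proof eventually_elim
        case (elim t)
        have 1: "h t powr \<gamma> = (d - 1/4) * ln t"
          using elim d1 \<gamma> by (simp add: h_def p_def powr_powr)
        have 2: "t ^ ?n = exp (d * ln t)"
          using elim by (simp add: d exp_of_nat_mult)
        have 3: "sqrt t = exp (ln t / 2)"
          using elim by (simp add: ln_sqrt[symmetric])
        have 4: "ln t powr (2 * p * d) = (ln t powr (2 / \<gamma>)) ^ ?n"
          using elim by (simp add: p_def d powr_powr flip: powr_realpow)
        have 5: "exp (- ln t / 4) = exp (d * ln t) * exp (- ((d - 1/4) * ln t)) / exp (ln t / 2)"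
          by (simp add: algebra_simps flip: exp_add exp_diff)
        show ?case
          unfolding P2_def power_mult_distrib 1 2 3 4 5 by simp
      qed
    qed
  qed
  have P3: "(P3 \<longlongrightarrow> 0) at_top"
    unfolding P3_def using C by real_asymp
  have G: "(G \<longlongrightarrow> exp (- (\<theta> * exp (- (\<gamma> * y))))) at_top"
  proof -
    have "filterlim (\<lambda>t. A' t powr \<gamma>) at_top at_top"
    proof (rule filterlim_at_top_mono)
      show "filterlim (\<lambda>t. d * ln t) at_top at_top"
        using d0 by real_asymp
      show "\<forall>\<^sub>F t in at_top. d * ln t \<le> A' t powr \<gamma>"
        unfolding A'_def by (rule level_powr_ge[OF \<gamma> d0])
    qed
    moreover have "((\<lambda>x::real. exp (- x)) \<longlongrightarrow> 0) at_top"
      by real_asymp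
    ultimately have "((\<lambda>t. exp (- (A' t powr \<gamma>))) \<longlongrightarrow> 0) at_top"
      by (rule filterlim_compose[rotated])
    then have "(G \<longlongrightarrow> exp (- (\<theta> * exp (- (\<gamma> * y)) / (1 - 0))) - 0 - 0) at_top"
      unfolding G_def by (intro tendsto_intros S P2 P3) auto
    then show ?thesis
      by simp
  qed
  have "\<forall>\<^sub>F t in at_top. G t \<le> prob {\<omega> \<in> space M. ln (mass t \<omega>) / t \<le> level \<gamma> d y 0 t}"
    using S_ge \<beta>_ge \<beta>_sqrt m_bound m_le far hK level_pos[OF \<gamma> d0, of y "-2", folded A'_def]
      ln_large[of 1] eventually_ge_at_top[of 1]
  proof eventually_elim
    case (elim t)
    define H where "H \<omega> = {z \<in> cube (m t). h t < \<xi> z \<omega>}" for \<omega>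
    define L where "L = {\<omega> \<in> space M. ln (mass t \<omega>) / t \<le> level \<gamma> d y 0 t}"
    define E1 where "E1 = {\<omega> \<in> space M. \<forall>z\<in>cube (m t). \<xi> z \<omega> \<le> A' t + \<beta> t / t * real (l1 z)}"
    define E2 where "E2 = {\<omega> \<in> space M. sqrt t < real (card (H \<omega>))}"
    define E3 where "E3 = {\<omega> \<in> space M. \<exists>z\<in>- cube (m t). real (l1 z) / t < \<xi> z \<omega>}"
    have t: "0 < t" "1 < ln t" "1 \<le> t"
      using elim by auto
    have h0: "0 \<le> h t"
      by (simp add: h_def)
    have K1: "1 \<le> K t"
    proof -
      have "0 < K t"
        unfolding K_def using \<kappa> t by (intro mult_pos_pos) auto
      then show ?thesis
        using elim(2) by (smt (verit) \<beta>_def ln_ge_zero_iff)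
    qed
    have L_meas: "L \<in> sets M"
      unfolding L_def using mass_measurable[OF t(1)] by measurable
    have E2_meas: "E2 \<in> sets M"
    proof -
      have "real (card (H \<omega>)) = (\<Sum>z\<in>cube (m t). if h t < \<xi> z \<omega> then 1 else 0)" for \<omega>
        by (simp add: H_def sum.If_cases Int_def)
      then show ?thesis
        unfolding E2_def by simp
    qed
    have E3_meas: "E3 \<in> sets M"
      unfolding E3_def by measurable
    have "AE \<omega> in M. \<omega> \<in> E1 \<longrightarrow> \<omega> \<in> L \<union> (E2 \<union> E3)"
      using pam AE_potential_nonneg
    proof eventually_elim
      case \<omega>: (elim \<omega>)
      show ?case
      proof
        assume E1: "\<omega> \<in> E1"
        show "\<omega> \<in> L \<union> (E2 \<union> E3)"
        proof (rule ccontr)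
          assume "\<omega> \<notin> L \<union> (E2 \<union> E3)"
          moreover have sp: "\<omega> \<in> space M"
            using E1 by (simp add: E1_def)
          ultimately have L: "\<omega> \<notin> L" and H: "real (card (H \<omega>)) \<le> sqrt t"
            and out: "\<And>z. z \<notin> cube (m t) \<Longrightarrow> \<xi> z \<omega> \<le> real (l1 z) / t"
            by (auto simp: E2_def E3_def not_less)
          have "total_mass (\<lambda>s z. u s z \<omega>) t \<le> 2 * exp (t * A t)"
          proof (rule total_mass_upper_bound_sparse_peaks(2)[OF \<omega>(1)])
            show "finite (H \<omega>)"
              by (simp add: H_def)
            show "h t + 2 * real CARD('d) * K t \<le> A t"
              using elim by (simp add: d)
          next
            fix z assume z: "z \<in> H \<omega>"
            have "2 * real (card (H \<omega>)) * (\<beta> t / t) \<le> 2 * sqrt t * (\<beta> t / t)"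
              using H elim by (intro mult_right_mono) auto
            also have "\<dots> = 2 * \<beta> t / sqrt t"
              using t by (simp add: divide_simps)
            finally have "2 * real (card (H \<omega>)) * (\<beta> t / t) \<le> 1"
              using elim by linarith
            moreover have "\<xi> z \<omega> \<le> A' t + \<beta> t / t * real (l1 z)"
              using E1 z by (simp add: E1_def H_def)
            moreover have "(real (l1 z) - 2 * real (card (H \<omega>))) * (\<beta> t / t) =
                \<beta> t / t * real (l1 z) - 2 * real (card (H \<omega>)) * (\<beta> t / t)"
              by (simp add: algebra_simps diff_divide_distrib)
            ultimately show "\<xi> z \<omega> \<le> A t + (real (l1 z) - 2 * real (card (H \<omega>))) * (ln (K t) / t)"
              unfolding \<beta>_def[symmetric] using AA'(2)[of t] by linarith
          next
            fix z assume z: "z \<notin> H \<omega>"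
            show "\<xi> z \<omega> \<le> h t + max 0 (real (l1 z) - 2 * real (card (H \<omega>))) * (ln (K t) / t)"
            proof (cases "z \<in> cube (m t)")
              case True
              then have "\<xi> z \<omega> \<le> h t"
                using z by (simp add: H_def not_less)
              moreover have "0 \<le> max 0 (real (l1 z) - 2 * real (card (H \<omega>))) * (ln (K t) / t)"
                using elim t by (intro mult_nonneg_nonneg) (auto simp: \<beta>_def)
              ultimately show ?thesis
                by linarith
            next
              case False
              have "4 * sqrt t \<le> real (l1 z)"
                using elim l1_gt_outside_cube[OF False] by linarith
              then have "real (l1 z) / 2 \<le> max 0 (real (l1 z) - 2 * real (card (H \<omega>)))"
                using H by linarith
              then have "real (l1 z) / 2 * (2 / t) \<le> max 0 (real (l1 z) - 2 * real (card (H \<omega>))) * (ln (K t) / t)"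
                using elim t by (intro mult_mono divide_right_mono) (auto simp: \<beta>_def)
              then show ?thesis
                using out[OF False] h0 by simp
            qed
          qed (use \<omega> t K1 h0 in auto)
          then have mass_le: "mass t \<omega> \<le> 2 * exp (t * A t)"
            .
          have "ln (mass t \<omega>) \<le> ln 2 + t * A t"
          proof (cases "0 < mass t \<omega>")
            case True
            then have "ln (mass t \<omega>) \<le> ln (2 * exp (t * A t))"
              using mass_le by simp
            then show ?thesis
              by (simp add: ln_mult)
          next
            case False
            moreover have "0 \<le> mass t \<omega>"
              unfolding total_mass_def using pam_nonneg[OF \<omega>(1)] t by (intro infsum_nonneg) auto
            ultimately have "mass t \<omega> = 0"
              by simp
            moreover have "0 < A t"
              using elim AA'(2)[of t] by simp
            ultimately show ?thesis
              using t by simp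
          qed
          also have "ln 2 + t * A t \<le> t * 1 + t * A t"
            using elim ln_2_less_1 by simp
          also have "\<dots> = t * level \<gamma> d y 0 t"
            unfolding AA'(1) by (simp add: algebra_simps)
          finally have "\<omega> \<in> L"
            using sp t by (simp add: L_def divide_le_eq mult.commute)
          with L show False ..
        qed
      qed
    qed
    then have "prob E1 \<le> prob (L \<union> (E2 \<union> E3))"
      by (rule finite_measure_mono_AE) (use L_meas E2_meas E3_meas in auto)
    also have "\<dots> \<le> prob L + prob (E2 \<union> E3)"
      by (rule measure_Un_le) (use L_meas E2_meas E3_meas in auto)
    also have "prob (E2 \<union> E3) \<le> prob E2 + prob E3"
      by (rule measure_Un_le) (use E2_meas E3_meas in auto)
    finally have "prob E1 \<le> prob L + (prob E2 + prob E3)"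
      by simp
    moreover have "prob E2 \<le> P2 t"
    proof -
      have "prob E2 \<le> real (card (cube (m t) :: (int ^ 'd) set)) * exp (- (h t powr \<gamma>)) / sqrt t"
        unfolding E2_def H_def by (rule prob_many_peaks) (use h0 t in auto)
      also have "real (card (cube (m t) :: (int ^ 'd) set)) = (2 * real (m t) + 1) ^ ?n"
        by (simp add: card_cube add.commute)
      also have "(2 * real (m t) + 1) ^ ?n * exp (- (h t powr \<gamma>)) / sqrt t \<le> P2 t"
        unfolding P2_def using elim t by (intro divide_right_mono mult_right_mono power_mono) auto
      finally show ?thesis .
    qed
    moreover have "prob E3 \<le> P3 t"
      unfolding E3_def P3_def
    proof (rule tail[THEN spec, THEN mp, OF t(3), THEN spec, THEN spec, THEN spec, THEN mp], intro ballI conjI)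
      fix z assume "z \<in> - cube (m t)"
      then have "real (m t) < real (l1 z)"
        using l1_gt_outside_cube by auto
      then have "t * ln t powr (2 / \<gamma>) \<le> real (l1 z)"
        using elim by linarith
      then have "ln t powr (2 / \<gamma>) \<le> real (l1 z) / t"
        using t by (simp add: le_divide_eq mult.commute)
      then have "(ln t powr (2 / \<gamma>)) powr \<gamma> \<le> (real (l1 z) / t) powr \<gamma>"
        using \<gamma> by (intro powr_mono2) auto
      moreover have "(ln t powr (2 / \<gamma>)) powr \<gamma> = (ln t)\<^sup>2"
        using \<gamma> t by (simp add: powr_powr)
      ultimately show "(ln t)\<^sup>2 / 2 + (real (l1 z) / t) powr \<gamma> / 2 \<le> (real (l1 z) / t) powr \<gamma>"
        by linarith
      show "0 \<le> real (l1 z) / t"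
        using t by simp
    qed
    moreover have "exp (- (S t / (1 - exp (- (A' t powr \<gamma>))))) \<le> prob E1"
    proof -
      have "0 < A' t"
        using elim by simp
      then have "0 < 1 - exp (- (A' t powr \<gamma>))"
        by simp
      then have "exp (- (S t / (1 - exp (- (A' t powr \<gamma>))))) \<le>
          exp (- ((\<Sum>z\<in>cube (m t). exp (- ((A' t + \<beta> t / t * real (l1 (z :: int ^ 'd))) powr \<gamma>))) / (1 - exp (- (A' t powr \<gamma>)))))"
        using elim(1) by (simp add: divide_right_mono)
      also have "\<dots> \<le> prob E1"
        unfolding E1_def by (rule prob_all_le_lower) (use elim t in auto)
      finally show ?thesis .
    qed
    ultimately show ?case
      unfolding G_def L_def[symmetric] by linarith
  qed
  with G show thesis
    using that unfolding \<theta>_def by blast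
qed

text \<open>A single site above \<open>A + 2 d + (\<beta>/t)\<bar>z\<bar>\<close> with \<open>\<beta> = ln A + 2\<close> forces \<open>L\<^sub>t > A\<close>. Here \<open>2 d\<close> is the
  rate at which the walk leaves the site, and the summand \<open>2\<close> of \<open>\<beta>\<close> accounts for the time \<open>\<bar>z\<bar>/A\<close>
  that is lost on the way: in the cube the threshold is at most \<open>2 A\<close>, so that at most \<open>2 \<bar>z\<bar>\<close>
  of the guaranteed exponent is lost.\<close>

lemma prob_small_mass_upper:
  obtains G where "(G \<longlongrightarrow> exp (- (2 ^ CARD('d) * d powr (d * (1 / \<gamma> - 1)) * exp (- (\<gamma> * y))))) at_top"
    "\<forall>\<^sub>F t in at_top. prob {\<omega> \<in> space M. ln (mass t \<omega>) / t \<le> level \<gamma> d y 0 t} \<le> G t"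
proof -
  let ?n = "CARD('d)"
  define p where "p = 1 / \<gamma>"
  have p: "1 < p"
    using \<gamma> by (simp add: p_def)
  have d0: "0 < d"
    by (simp add: d)
  define \<theta> where "\<theta> = 2 ^ ?n * d powr (d * (1 / \<gamma> - 1))"
  define A where "A = level \<gamma> d y 0"
  define A' where "A' = level \<gamma> d y (2 * d)"
  have AA': "A' t = A t + 2 * d" for t
    by (simp add: A_def A'_def level_def)
  define \<beta> where "\<beta> t = ln (A t) + 2" for t
  define m where "m t = nat \<lceil>t * ln t powr (p - 1)\<rceil>" for t
  define G where "G t = exp (- (exp (- (A' t powr \<gamma>)) * (\<Sum>z\<in>cube (m t).
      exp (- (\<gamma> * A' t powr (\<gamma> - 1) * (\<beta> t / t) * real (l1 (z :: int ^ 'd)))))))" for t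
  have \<beta>_lim: "((\<lambda>t. \<beta> t / ln (ln t)) \<longlongrightarrow> 1 / \<gamma>) at_top"
  proof -
    have "((\<lambda>t::real. 2 / ln (ln t)) \<longlongrightarrow> 0) at_top"
      by real_asymp
    then have "((\<lambda>t. ln (A t) / ln (ln t) + 2 / ln (ln t)) \<longlongrightarrow> 1 / \<gamma> + 0) at_top"
      unfolding A_def by (intro tendsto_add ln_level_ratio[OF \<gamma> d0])
    then show ?thesis
      by (simp add: \<beta>_def add_divide_distrib)
  qed
  have \<beta>_ge: "\<forall>\<^sub>F t in at_top. 1 \<le> \<beta> t"
  proof -
    have "filterlim (\<lambda>t. \<beta> t / ln (ln t) * ln (ln t)) at_top at_top"
      by (rule filterlim_tendsto_pos_mult_at_top[OF \<beta>_lim])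
        (use \<gamma> in \<open>auto intro: filterlim_compose[OF ln_at_top ln_at_top]\<close>)
    then have "\<forall>\<^sub>F t in at_top. 1 \<le> \<beta> t / ln (ln t) * ln (ln t)"
      unfolding filterlim_at_top by blast
    then show ?thesis
      using ln_ln_large[of 0] by eventually_elim simp
  qed
  have m_bound: "\<forall>\<^sub>F t in at_top. t * ln t powr (p - 1) \<le> real (m t) \<and> real (m t) \<le> 2 * (t * ln t powr (p - 1))"
    using ln_large[of 1] eventually_ge_at_top[of 1]
  proof eventually_elim
    case (elim t)
    have "1 * 1 \<le> t * ln t powr (p - 1)"
      using elim p by (intro mult_mono ge_one_powr_ge_zero) auto
    then show ?case
      unfolding m_def by linarith
  qed
  have A_large: "\<forall>\<^sub>F t in at_top. 2 * d + \<beta> t * (2 * d * ln t powr (p - 1)) \<le> A t"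
  proof -
    have lim: "((\<lambda>t. A t / ln t powr p - 2 * d / ln t powr p - 2 * d * (\<beta> t / ln (ln t)) * (ln (ln t) / ln t))
        \<longlongrightarrow> d powr p - 0 - 2 * d * (1 / \<gamma>) * 0) at_top"
    proof (intro tendsto_diff tendsto_mult tendsto_const \<beta>_lim)
      show "((\<lambda>t. A t / ln t powr p) \<longlongrightarrow> d powr p) at_top"
        unfolding A_def p_def by (rule level_ratio[OF \<gamma> d0])
      show "((\<lambda>t. 2 * d / ln t powr p) \<longlongrightarrow> 0) at_top"
        using p by real_asymp
      show "((\<lambda>t::real. ln (ln t) / ln t) \<longlongrightarrow> 0) at_top"
        by real_asymp
    qed
    have "\<forall>\<^sub>F t in at_top. 0 < A t / ln t powr p - 2 * d / ln t powr p - 2 * d * (\<beta> t / ln (ln t)) * (ln (ln t) / ln t)"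
      by (rule order_tendstoD(1)[OF lim]) (use d0 in simp)
    then show ?thesis
      using ln_large[of 0] ln_ln_large[of 0]
    proof eventually_elim
      case (elim t)
      have "2 * d * (\<beta> t / ln (ln t)) * (ln (ln t) / ln t) = \<beta> t * (2 * d * ln t powr (p - 1)) / ln t powr p"
        using elim by (simp add: powr_diff)
      then have "0 < (A t - (2 * d + \<beta> t * (2 * d * ln t powr (p - 1)))) / ln t powr p"
        using elim(1) by (simp add: diff_divide_distrib add_divide_distrib)
      then show ?case
        using elim by (simp add: zero_less_divide_iff)
    qed
  qed
  have "((\<lambda>t. exp (- (A' t powr \<gamma>)) * (\<Sum>z\<in>cube (m t).
      exp (- (\<gamma> * A' t powr (\<gamma> - 1) * (\<beta> t / t) * real (l1 (z :: int ^ 'd)))))) \<longlongrightarrow> \<theta> * exp (- (\<gamma> * y))) at_top"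
    unfolding A'_def \<theta>_def
    by (rule level_sum_tendsto[OF \<gamma> d \<beta>_lim]) (use m_bound in \<open>auto simp: p_def elim: eventually_mono\<close>)
  then have G: "(G \<longlongrightarrow> exp (- (\<theta> * exp (- (\<gamma> * y))))) at_top"
    unfolding G_def by (intro tendsto_exp tendsto_minus)
  have "\<forall>\<^sub>F t in at_top. prob {\<omega> \<in> space M. ln (mass t \<omega>) / t \<le> level \<gamma> d y 0 t} \<le> G t"
    using \<beta>_ge m_bound A_large level_pos[OF \<gamma> d0, of y 0, folded A_def]
      level_pos[OF \<gamma> d0, of y "2 * d", folded A'_def] ln_large[of 0] eventually_ge_at_top[of 1]
  proof eventually_elim
    case (elim t)
    define q where "q z = A' t + \<beta> t / t * real (l1 z)" for z :: "int ^ 'd"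
    have t: "0 < t"
      using elim by simp
    have q0: "0 \<le> q z" for z
      using elim t by (simp add: q_def)
    have "AE \<omega> in M. \<omega> \<in> {\<omega> \<in> space M. ln (mass t \<omega>) / t \<le> level \<gamma> d y 0 t} \<longrightarrow>
        \<omega> \<in> {\<omega> \<in> space M. \<forall>z\<in>cube (m t). \<xi> z \<omega> \<le> q z}"
      using pam AE_potential_nonneg AE_summable[OF elim(7)]
    proof eventually_elim
      case \<omega>: (elim \<omega>)
      have "A t < ln (mass t \<omega>) / t" if z: "z \<in> cube (m t)" "q z < \<xi> z \<omega>" for z
      proof -
        define k where "k = real (l1 z)"
        have "real (l1 z) \<le> real (CARD('d) * m t)"
          using l1_le_in_cube[OF z(1)] by (simp only: of_nat_le_iff)
        then have "k \<le> d * real (m t)"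
          by (simp add: k_def d)
        also have "\<dots> \<le> d * (2 * (t * ln t powr (p - 1)))"
          using elim d0 by (intro mult_left_mono) auto
        finally have k: "k / t \<le> 2 * d * ln t powr (p - 1)"
          using t by (simp add: divide_le_eq mult_ac)
        have "\<beta> t * (k / t) \<le> \<beta> t * (2 * d * ln t powr (p - 1))"
          using elim by (intro mult_left_mono k) auto
        then have \<beta>k: "2 * d + \<beta> t * (k / t) \<le> A t"
          using elim by linarith
        have q_le: "q z \<le> 2 * A t"
          using \<beta>k AA'[of t] by (simp add: q_def k_def)
        have "1 * (k / t) \<le> \<beta> t * (k / t)"
          using elim t by (intro mult_right_mono) (auto simp: k_def)
        then have "k / t < A t"
          using \<beta>k d0 by linarith
        then have kA: "k < t * A t" "k / A t < t"
          using t elim by (auto simp: divide_less_eq mult.commute)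
        have "(t - k / A t) * q z < (t - k / A t) * \<xi> z \<omega>"
          using kA z(2) by (intro mult_strict_left_mono) auto
        moreover have "t * q z - 2 * k \<le> (t - k / A t) * q z"
        proof -
          have "k / A t * q z \<le> k / A t * (2 * A t)"
            using elim q_le by (intro mult_left_mono) (auto simp: k_def)
          also have "\<dots> = 2 * k"
            using elim by simp
          finally show ?thesis
            by (simp add: left_diff_distrib)
        qed
        moreover have "t * q z = t * A t + 2 * d * t + k * ln (A t) + 2 * k"
          using t by (simp add: q_def AA' \<beta>_def k_def field_simps)
        moreover have "(t - k / A t) * \<xi> z \<omega> - k * ln (A t) - 2 * d * t \<le> ln (mass t \<omega>)"
          unfolding k_def d
          by (rule ln_total_mass_lower_bound[OF \<omega>(1)]) (use \<omega> t elim kA in \<open>auto simp: k_def\<close>)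
        ultimately have "t * A t < ln (mass t \<omega>)"
          by linarith
        then show ?thesis
          using t by (simp add: less_divide_eq mult.commute)
      qed
      then show ?case
        unfolding A_def by (force simp: not_less[symmetric])
    qed
    then have "prob {\<omega> \<in> space M. ln (mass t \<omega>) / t \<le> level \<gamma> d y 0 t} \<le>
        prob {\<omega> \<in> space M. \<forall>z\<in>cube (m t). \<xi> z \<omega> \<le> q z}"
      by (rule finite_measure_mono_AE) auto
    also have "\<dots> \<le> exp (- (\<Sum>z\<in>cube (m t). exp (- (q z powr \<gamma>))))"
      by (rule prob_all_le_upper) (auto intro: q0)
    also have "\<dots> \<le> G t"
    proof -
      have "exp (- (A' t powr \<gamma>)) * (\<Sum>z\<in>cube (m t). exp (- (\<gamma> * A' t powr (\<gamma> - 1) * (\<beta> t / t) * real (l1 (z :: int ^ 'd)))))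
          \<le> (\<Sum>z\<in>cube (m t). exp (- (q z powr \<gamma>)))"
        unfolding A'_def q_def by (rule level_sum_lower[OF \<gamma> d]) (use elim t in \<open>auto simp: A'_def\<close>)
      then show ?thesis
        by (simp add: G_def)
    qed
    finally show ?case .
  qed
  with G show thesis
    using that unfolding \<theta>_def by blast
qed

lemma prob_small_mass_tendsto:
  "((\<lambda>t. prob {\<omega> \<in> space M. ln (mass t \<omega>) / t \<le> level \<gamma> d y 0 t}) \<longlongrightarrow>
    exp (- (2 ^ CARD('d) * d powr (d * (1 / \<gamma> - 1)) * exp (- (\<gamma> * y))))) at_top"
proof -
  let ?F = "exp (- (2 ^ CARD('d) * d powr (d * (1 / \<gamma> - 1)) * exp (- (\<gamma> * y))))"
  obtain G1 where G1: "(G1 \<longlongrightarrow> ?F) at_top"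
    "\<forall>\<^sub>F t in at_top. G1 t \<le> prob {\<omega> \<in> space M. ln (mass t \<omega>) / t \<le> level \<gamma> d y 0 t}"
    by (rule prob_small_mass_lower)
  obtain G2 where G2: "(G2 \<longlongrightarrow> ?F) at_top"
    "\<forall>\<^sub>F t in at_top. prob {\<omega> \<in> space M. ln (mass t \<omega>) / t \<le> level \<gamma> d y 0 t} \<le> G2 t"
    by (rule prob_small_mass_upper)
  show ?thesis
    by (rule tendsto_sandwich[OF G1(2) G2(2) G1(1) G2(1)])
qed

end

end

theorem theorem1p4:
  fixes M :: "'a measure"
    and N :: "'b measure"
    and \<xi> :: "int ^ 'd \<Rightarrow> 'a \<Rightarrow> real"
    and u :: "real \<Rightarrow> int ^ 'd \<Rightarrow> 'a \<Rightarrow> real"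
    and U L :: "real \<Rightarrow> 'a \<Rightarrow> real"
    and Y :: "'b \<Rightarrow> real"
    and \<gamma> d \<theta> :: real
  assumes "d = real CARD('d)"
    and "0 < \<gamma>" "\<gamma> < 1"
    and "prob_space M"
    and "prob_space.indep_vars M (\<lambda>_. borel) \<xi> UNIV"
    and "\<And>z x. measure M {\<omega> \<in> space M. \<xi> z \<omega> \<le> x} = weibull_cdf \<gamma> x"
    and "\<And>t z. t > 0 \<Longrightarrow> u t z \<in> borel_measurable M"
    and "AE \<omega> in M. pam_solution (\<lambda>z. \<xi> z \<omega>) (\<lambda>t z. u t z \<omega>)"
    and "\<And>t \<omega>. U t \<omega> = total_mass (\<lambda>s z. u s z \<omega>) t"
    and "\<And>t \<omega>. L t \<omega> = 1 / t * ln (U t \<omega>)"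
    and "\<theta> = 2 ^ CARD('d) * d powr (d * (1 / \<gamma> - 1))"
    and "prob_space N" "Y \<in> borel_measurable N"
    and "\<And>y. measure N {\<omega> \<in> space N. Y \<omega> \<le> y} = exp (- (\<theta> * exp (- (\<gamma> * y))))"
  shows "weak_conv_along
      (\<lambda>t. distr M borel (\<lambda>\<omega>.
         (L t \<omega>
           - (d * ln t) powr (1 / \<gamma>)
           - d * (1 / \<gamma>\<^sup>2 - 1 / \<gamma>) * (d * ln t) powr (1 / \<gamma> - 1) * ln (ln t)
           + d / \<gamma> * (d * ln t) powr (1 / \<gamma> - 1) * ln (ln (ln t)))
         / (d * ln t) powr (1 / \<gamma> - 1)))
      (distr N borel Y) at_top"
  unfolding weak_conv_along_def
proof (intro allI impI)
  fix y
  interpret weibull_potential M \<xi> \<gamma>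
    using assms(2-6) by (intro weibull_potential.intro weibull_potential_axioms.intro) auto
  have d0: "0 < d"
    using assms(1) by simp
  let ?X = "\<lambda>t \<omega>. (L t \<omega> - (d * ln t) powr (1 / \<gamma>)
      - d * (1 / \<gamma>\<^sup>2 - 1 / \<gamma>) * (d * ln t) powr (1 / \<gamma> - 1) * ln (ln t)
      + d / \<gamma> * (d * ln t) powr (1 / \<gamma> - 1) * ln (ln (ln t))) / (d * ln t) powr (1 / \<gamma> - 1)"
  let ?mass = "\<lambda>t \<omega>. total_mass (\<lambda>s z. u s z \<omega>) t"
  have "cdf (distr N borel Y) y = measure N {\<omega> \<in> space N. Y \<omega> \<le> y}"
    using assms(13) by (simp add: cdf_def measure_distr vimage_def Int_def conj_commute)
  then have F: "cdf (distr N borel Y) y = exp (- (2 ^ CARD('d) * d powr (d * (1 / \<gamma> - 1)) * exp (- (\<gamma> * y))))"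
    using assms(14) by (simp add: assms(11))
  have lim: "((\<lambda>t. prob {\<omega> \<in> space M. ln (?mass t \<omega>) / t \<le> level \<gamma> d y 0 t}) \<longlongrightarrow> cdf (distr N borel Y) y) at_top"
    unfolding F by (rule prob_small_mass_tendsto[OF assms(1) _ assms(8)]) (rule assms(7))
  show "((\<lambda>t. cdf (distr M borel (?X t)) y) \<longlongrightarrow> cdf (distr N borel Y) y) at_top"
  proof (rule Lim_transform_eventually[OF lim])
    show "\<forall>\<^sub>F t in at_top. prob {\<omega> \<in> space M. ln (?mass t \<omega>) / t \<le> level \<gamma> d y 0 t} =
        cdf (distr M borel (?X t)) y"
      using eventually_gt_at_top[of 0] ln_large[of 0]
    proof eventually_elim
      case (elim t)
      define \<sigma> where "\<sigma> = (d * ln t) powr (1 / \<gamma> - 1)"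
      have \<sigma>: "0 < \<sigma>"
        using elim d0 by (simp add: \<sigma>_def)
      have LU: "L t = (\<lambda>\<omega>. 1 / t * ln (?mass t \<omega>))"
        by (rule ext) (simp add: assms(9,10))
      have "L t \<in> borel_measurable M"
        unfolding LU using total_mass_measurable[of u t M] assms(7) elim by measurable
      then have "?X t \<in> borel_measurable M"
        by measurable
      then have "cdf (distr M borel (?X t)) y = prob {\<omega> \<in> space M. ?X t \<omega> \<le> y}"
        by (simp add: cdf_def measure_distr vimage_def Int_def conj_commute)
      also have "{\<omega> \<in> space M. ?X t \<omega> \<le> y} = {\<omega> \<in> space M. ln (?mass t \<omega>) / t \<le> level \<gamma> d y 0 t}"
        using \<sigma> by (auto simp: LU level_def scale_def \<sigma>_def[symmetric] divide_le_eq algebra_simps)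
      finally show ?case ..
    qed
  qed
qed

end
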